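(* Fix an integer $k\geq 2$, and let $\{f_n\}_{n\geq 1}$ be a sequence of elements of $\mathfrak{H}^{\odot k}$. Assume that $f_\infty=\lim_{n\to\infty}f_n$ exists in $\mathfrak{H}^{\otimes k}$ and that each $f_n$ as well as $f_\infty$ are not identically zero. Then there exists a constant $c$, depending only on $k$ and $f_\infty$, such that, for all $n\geq 1$, $$d_{TV}(I_k(f_n),I_k(f_\infty))\leq c\,\|f_n-f_\infty\|_{\mathfrak{H}^{\otimes k}}^{\frac{1}{2k}}.$$
   Context: Let $\mathfrak{H}$ be a real separable Hilbert space, with $k$th tensor power $\mathfrak{H}^{\otimes k}$ and $k$th symmetric tensor power $\mathfrak{H}^{\odot k}$. Let $X=\{X(h):h\in\mathfrak{H}\}$ be an isonormal Gaussian process over $\mathfrak{H}$: a centered Gaussian family on a probability space $(\Omega,\mathcal{F},P)$ with $E[X(h)X(g)]=\langle h,g\rangle_{\mathfrak{H}}$ and $\mathcal{F}=\sigma(X)$. Let $H_k(x)=(-1)^k e^{x^2/2}\frac{d^k}{dx^k}\big(e^{-x^2/2}\big)$ be the $k$th Hermite polynomial, and let the $k$th Wiener chaos $\mathcal{H}_k$ be the closed linear span in $L^2(\Omega)$ of $\{H_k(X(h)):\|h\|_{\mathfrak{H}}=1\}$. The $k$th multiple Wiener-Itô integral $I_k$ is the unique linear isometry from $\mathfrak{H}^{\odot k}$, equipped with the modified norm $\sqrt{k!}\,\|\cdot\|_{\mathfrak{H}^{\otimes k}}$, onto $\mathcal{H}_k$ such that $I_k(h^{\otimes k})=H_k(X(h))$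 for all $h\in\mathfrak{H}$ with $\|h\|_{\mathfrak{H}}=1$. For real random variables $F,G$, $d_{TV}(F,G)=\sup_{A\in\mathcal{B}(\mathbb{R})}|P(F\in A)-P(G\in A)|$. *)

theory Defs
  imports "HOL-Probability.Probability" "HOL-Combinatorics.Permutations"
begin

text \<open>
  A model of the \<open>k\<close>th Hilbert tensor power of \<open>'h\<close>: a Hilbert space \<open>'t\<close> together with a map
  \<open>t\<close> taking \<open>(x 0, \<dots>, x (k - 1))\<close> to the elementary tensor \<open>x 0 \<otimes> \<dots> \<otimes> x (k - 1)\<close>. The inner
  product formula forces \<open>t\<close> to ignore the entries \<open>x i\<close> with \<open>i \<ge> k\<close> and to be multilinear in the
  others (see \<open>hilbert_tensor_power_multilinear\<close>). Together with totality of the elementary tensors it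
  determines the pair up to a unique isometric isomorphism.
\<close>

definition hilbert_tensor_power ::
  "nat \<Rightarrow> ((nat \<Rightarrow> 'h::{real_inner, complete_space}) \<Rightarrow> 't::{real_inner, complete_space}) \<Rightarrow> bool"
  where
  "hilbert_tensor_power k t \<longleftrightarrow>
     (\<forall>x y. t x \<bullet> t y = (\<Prod>i<k. x i \<bullet> y i)) \<and>
     closure (span (range t)) = UNIV"

lemma hilbert_tensor_power_multilinear:
  assumes t: "hilbert_tensor_power k t" and i: "i < k"
  shows "t (x(i := a *\<^sub>R u + v)) = a *\<^sub>R t (x(i := u)) + t (x(i := v))"
proof -
  have ip: "t x \<bullet> t y = (\<Prod>i<k. x i \<bullet> y i)" for x y
    using t by (simp add: hilbert_tensor_power_def)
  have split: "t (x(i := w)) \<bullet> t y = (w \<bullet> y i) * (\<Prod>j\<in>{..<k} - {i}. x j \<bullet> y j)" for w y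
    unfolding ip using i by (subst prod.remove[of _ i]) auto
  let ?d = "t (x(i := a *\<^sub>R u + v)) - (a *\<^sub>R t (x(i := u)) + t (x(i := v)))"
  have orth: "?d \<bullet> t y = 0" for y
    by (simp only: inner_diff_left inner_add_left inner_scaleR_left split) (simp add: algebra_simps)
  have "?d \<bullet> ?d = ?d \<bullet> t (x(i := a *\<^sub>R u + v))
      - (a * (?d \<bullet> t (x(i := u))) + ?d \<bullet> t (x(i := v)))"
    by (simp only: inner_diff_right inner_add_right inner_scaleR_right)
  then have "?d \<bullet> ?d = 0" by (simp only: orth mult_zero_right add_0_right diff_self)
  then show ?thesis by simp
qed

definition symmetrized_tensor ::
  "nat \<Rightarrow> ((nat \<Rightarrow> 'h) \<Rightarrow> 't::real_vector) \<Rightarrow> (nat \<Rightarrow> 'h) \<Rightarrow> 't" where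
  "symmetrized_tensor k t x = (1 / fact k) *\<^sub>R (\<Sum>p | p permutes {..<k}. t (x \<circ> p))"

definition symmetric_tensor_power ::
  "nat \<Rightarrow> ((nat \<Rightarrow> 'h) \<Rightarrow> 't::real_normed_vector) \<Rightarrow> 't set" where
  "symmetric_tensor_power k t = closure (span (range (symmetrized_tensor k t)))"

definition hermite :: "nat \<Rightarrow> real \<Rightarrow> real" where
  "hermite k x = (-1) ^ k * exp (x\<^sup>2 / 2) * (deriv ^^ k) (\<lambda>y. exp (- (y\<^sup>2 / 2))) x"

text \<open>Degenerate (almost surely zero) variables count as Gaussian.\<close>

definition centered_gaussian :: "'w measure \<Rightarrow> ('w \<Rightarrow> real) \<Rightarrow> bool" where
  "centered_gaussian M Z \<longleftrightarrow>
     Z \<in> borel_measurable M \<and>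
     ((\<exists>s>0. distributed M lborel Z (normal_density 0 s)) \<or> (AE w in M. Z w = 0))"

locale isonormal_process = prob_space M
  for M :: "'w measure" and X :: "'h::{real_inner, complete_space} \<Rightarrow> 'w \<Rightarrow> real" +
  assumes gaussian_family:
      "finite S \<Longrightarrow> centered_gaussian M (\<lambda>w. \<Sum>h\<in>S. a h * X h w)"
    and covariance: "expectation (\<lambda>w. X h w * X g w) = h \<bullet> g"
    and generated: "sets M = sigma_sets (space M) {X h -` A \<inter> space M | h A. A \<in> sets borel}"

definition square_integrable :: "'w measure \<Rightarrow> ('w \<Rightarrow> real) \<Rightarrow> bool" where
  "square_integrable M F \<longleftrightarrow> F \<in> borel_measurable M \<and> integrable M (\<lambda>w. (F w)\<^sup>2)"

definition L2_norm :: "'w measure \<Rightarrow> ('w \<Rightarrow> real) \<Rightarrow> real" where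
  "L2_norm M F = sqrt (\<integral>w. (F w)\<^sup>2 \<partial>M)"

text \<open>
  The closed linear span in \<open>L\<^sup>2(M)\<close> of the variables \<open>H\<^sub>k(X(h))\<close>, \<open>\<parallel>h\<parallel> = 1\<close>, as a set of
  functions closed under almost sure equality.
\<close>

definition wiener_chaos ::
  "nat \<Rightarrow> 'w measure \<Rightarrow> ('h::real_normed_vector \<Rightarrow> 'w \<Rightarrow> real) \<Rightarrow> ('w \<Rightarrow> real) set" where
  "wiener_chaos k M X =
     {F. square_integrable M F \<and>
         (\<forall>e>0. \<exists>S a. finite S \<and> (\<forall>h\<in>S. norm h = 1) \<and>
            L2_norm M (\<lambda>w. F w - (\<Sum>h\<in>S. a h * hermite k (X h w))) < e)}"

text \<open>
  \<open>I\<close> is a choice of representatives of the \<open>k\<close>th multiple Wiener-Ito integral. Elements of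
  \<open>L\<^sup>2(M)\<close> are functions up to almost sure equality, so these conditions determine each \<open>I f\<close> with
  \<open>f\<close> symmetric up to almost sure equality; the values of \<open>I\<close> at other tensors are irrelevant.
\<close>

definition multiple_wiener_integral ::
  "nat \<Rightarrow> ((nat \<Rightarrow> 'h::{real_inner, complete_space}) \<Rightarrow> 't::{real_inner, complete_space}) \<Rightarrow>
   'w measure \<Rightarrow> ('h \<Rightarrow> 'w \<Rightarrow> real) \<Rightarrow> ('t \<Rightarrow> 'w \<Rightarrow> real) \<Rightarrow> bool" where
  "multiple_wiener_integral k t M X I \<longleftrightarrow>
     (\<forall>f\<in>symmetric_tensor_power k t. I f \<in> wiener_chaos k M X) \<and>
     (\<forall>f\<in>symmetric_tensor_power k t. \<forall>g\<in>symmetric_tensor_power k t. \<forall>a b.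
        AE w in M. I (a *\<^sub>R f + b *\<^sub>R g) w = a * I f w + b * I g w) \<and>
     (\<forall>f\<in>symmetric_tensor_power k t. L2_norm M (I f) = sqrt (fact k) * norm f) \<and>
     (\<forall>F\<in>wiener_chaos k M X. \<exists>f\<in>symmetric_tensor_power k t. AE w in M. I f w = F w) \<and>
     (\<forall>h. norm h = 1 \<longrightarrow> (AE w in M. I (t (\<lambda>_. h)) w = hermite k (X h w)))"

definition tv_dist :: "'w measure \<Rightarrow> ('w \<Rightarrow> real) \<Rightarrow> ('w \<Rightarrow> real) \<Rightarrow> real" where
  "tv_dist M F G = (SUP A\<in>sets (borel :: real measure).
     \<bar>measure M {w \<in> space M. F w \<in> A} - measure M {w \<in> space M. G w \<in> A}\<bar>)"

end

theory Submission
  imports Defs "HOL-Computational_Algebra.Fundamental_Theorem_Algebra"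
begin

text \<open>
  Choose a unit vector \<open>h\<close> with \<open>a = \<langle>f\<^sub>\<infinity>, h\<^sup>\<otimes>\<^sup>k\<rangle> \<noteq> 0\<close>. Splitting every direction into its
  component along \<open>h\<close> and an orthogonal remainder, a chaos variable becomes, conditionally on the
  remainders, a real polynomial of degree \<open>k\<close> in the standard Gaussian \<open>X(h)\<close>, and the coefficient
  of degree \<open>k\<close> is deterministic; for \<open>I\<^sub>k(f\<^sub>\<infinity>)\<close> it is \<open>a\<close>. So it suffices to compare the laws of two
  polynomials \<open>P\<close>, \<open>Q\<close> of one Gaussian variable. For a test function \<open>\<phi>\<close> with antiderivative \<open>\<Phi>\<close>,
  integration by parts of \<open>(\<Phi>(P) - \<Phi>(Q)) P' / (P'\<^sup>2 + \<epsilon>)\<close> bounds the difference of the expectations by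
  \<open>O(\<parallel>P - Q\<parallel> / \<epsilon>)\<close>, with constants coming from the equivalence of norms on polynomials of degree
  at most \<open>k\<close>, plus \<open>2 E[\<epsilon> / (P'\<^sup>2 + \<epsilon>)]\<close>. The latter is small because \<open>\<bar>P'\<bar>\<close> is at least
  \<open>k \<bar>a\<bar> s ^ (k - 1)\<close> outside the \<open>s\<close>-neighbourhoods of the real parts of its \<open>k - 1\<close> complex roots. With
  \<open>\<epsilon> = s ^ (2 * k - 1)\<close> and \<open>s ^ (2 * k) = \<parallel>f\<^sub>n - f\<^sub>\<infinity>\<parallel>\<close> every term is \<open>O(s)\<close>.
\<close>

section \<open>Polynomials of a standard Gaussian variable\<close>

text \<open>The polynomial in \<open>X(h)\<close> is explicit only for finite Hermite sums, and an
  element of the chaos is merely an \<open>L\<^sup>2\<close> limit of such sums. Hence the laws are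
  tested with Lipschitz functions bounded by 1. The approximating sums may be chosen after the
  Lipschitz constant, while the estimate for the sums uses only boundedness and continuity, so the
  final bound does not see that constant and passes to closed sets and then to Borel sets.

  For a unit vector \<open>g\<close>, \<open>X(g)\<close> is
  \<open>\<langle>g,h\<rangle> X(h)\<close> plus a remainder, and \<open>H\<^sub>k\<close> is monic.
  So \<open>H\<^sub>k(X(g))\<close> contributes exactly
  \<open>\<langle>g,h\<rangle>\<^sup>k\<close>, the pairing of the two diagonal tensors, to the
  coefficient of degree \<open>k\<close>, whatever the remainder is.

  The weight in the integration by parts is built from \<open>P\<close> alone, the polynomial of the
  limit. The leading coefficient of \<open>Q\<close> is never divided by, so one constant serves
  every \<open>n\<close>, with no restriction to large \<open>n\<close>.

  The vector \<open>h\<close> exists because a symmetric tensor orthogonal to all diagonal tensors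
  would have a multiple integral orthogonal to every \<open>H\<^sub>k(X(h))\<close>, hence to its
  own approximations.\<close>

abbreviation gauss_int :: "(real \<Rightarrow> real) \<Rightarrow> real" where
  "gauss_int f \<equiv> integral\<^sup>L std_normal_distribution f"

lemma prob_space_std_normal: "prob_space std_normal_distribution"
  using real_dist_normal_dist by (simp add: real_distribution_def)

lemma integrable_std_normal_poly:
  "integrable std_normal_distribution (poly p)"
proof -
  have "poly p = (\<lambda>x. \<Sum>i\<le>degree p. coeff p i * x ^ i)" by (simp add: poly_altdef fun_eq_iff)
  then show ?thesis
    by (auto intro!: Bochner_Integration.integrable_sum integrable_mult_right
        integrable_std_normal_distribution_moment)
qed

lemma borel_measurable_poly [measurable]: "poly (p :: real poly) \<in> borel_measurable borel"
  by (intro borel_measurable_continuous_onI continuous_intros)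

lemma integrable_std_normal_poly_bound:
  assumes [measurable]: "f \<in> borel_measurable borel" and "\<And>x. \<bar>f x\<bar> \<le> \<bar>poly p x\<bar>"
  shows "integrable std_normal_distribution f"
  by (rule Bochner_Integration.integrable_bound[OF integrable_std_normal_poly[of p]])
     (use assms in auto)

section \<open>Gaussian integration by parts for functions of polynomial growth\<close>

lemma std_normal_density_le_1: "std_normal_density x \<le> 1"
proof -
  have "1 \<le> sqrt (2 * pi)" using pi_gt3 by (simp add: real_le_rsqrt)
  moreover have "exp (- x\<^sup>2 / 2) \<le> 1" by simp
  ultimately have "1 / sqrt (2 * pi) * exp (- x\<^sup>2 / 2) \<le> 1 * 1"
    by (intro mult_mono) auto
  then show ?thesis by (simp add: std_normal_density_def)
qed

lemma poly_times_std_normal_density_tendsto_0_top: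
  "((\<lambda>x. poly p x * std_normal_density x) \<longlongrightarrow> 0) at_top"
proof -
  have "((\<lambda>x::real. x ^ i * std_normal_density x) \<longlongrightarrow> 0) at_top" for i
  proof (rule Lim_null_comparison)
    show "((\<lambda>x::real. x ^ i / exp x * exp 1) \<longlongrightarrow> 0) at_top"
      using tendsto_mult_left_zero[OF tendsto_power_div_exp_0] by simp
    show "\<forall>\<^sub>F x::real in at_top. norm (x ^ i * std_normal_density x) \<le> x ^ i / exp x * exp 1"
      using eventually_ge_at_top[of 0]
    proof eventually_elim
      case (elim x)
      \<comment> \<open>This trades the Gaussian tail for \<open>exp (1 - x)\<close>, which leaves
        the standard limit of a power over an exponential.\<close>
      have "(x - 1)\<^sup>2 \<ge> 0" by simp
      then have "- x\<^sup>2 / 2 \<le> 1 - x" by (simp add: power2_eq_square field_simps)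
      then have "exp (- x\<^sup>2 / 2) \<le> exp (1 - x)" by simp
      moreover have "1 \<le> sqrt (2 * pi)" using pi_gt3 by (simp add: real_le_rsqrt)
      then have "1 / sqrt (2 * pi) \<le> 1" by simp
      ultimately have "std_normal_density x \<le> 1 * exp (1 - x)" unfolding std_normal_density_def
        by (intro mult_mono) auto
      then have "std_normal_density x \<le> exp (1 - x)" by simp
      then show ?case using elim
        by (simp add: exp_diff normal_density_nonneg mult_left_mono mult.commute)
           (metis mult_left_mono times_divide_eq_right zero_le_power mult.commute)
    qed
  qed
  then have "((\<lambda>x. \<Sum>i\<le>degree p. coeff p i * (x ^ i * std_normal_density x)) \<longlongrightarrow> (\<Sum>i\<le>degree p. coeff p i * 0)) at_top"
    by (intro tendsto_sum tendsto_mult_left)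
  then show ?thesis by (simp add: poly_altdef sum_distrib_right mult.assoc)
qed

lemma poly_times_std_normal_density_tendsto_0_bot:
  "((\<lambda>x. poly p x * std_normal_density x) \<longlongrightarrow> 0) at_bot"
proof -
  have "((\<lambda>x. poly (pcompose p [:0, -1:]) x * std_normal_density x) \<longlongrightarrow> 0) at_top"
    by (rule poly_times_std_normal_density_tendsto_0_top)
  then show ?thesis unfolding filterlim_at_bot_mirror
    by (simp add: poly_pcompose std_normal_density_def)
qed

lemma std_normal_density_has_derivative:
  "(std_normal_density has_real_derivative (- x * std_normal_density x)) (at x)"
  unfolding std_normal_density_def [abs_def]
  by (auto intro!: derivative_eq_intros simp: field_simps)

text \<open>\<open>f' x - x * f x\<close>, times the density, is the derivative of \<open>f\<close>
  times the density. The polynomial bounds make it integrable and annihilate the boundary terms at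
  both ends.\<close>

lemma gaussian_integration_by_parts:
  fixes f f' :: "real \<Rightarrow> real"
  assumes der: "\<And>x. (f has_real_derivative f' x) (at x)" and cont: "continuous_on UNIV f'"
    and bd: "\<And>x. \<bar>f x\<bar> \<le> \<bar>poly p x\<bar>" and bd': "\<And>x. \<bar>f' x\<bar> \<le> \<bar>poly q x\<bar>"
  shows "gauss_int (\<lambda>x. f' x - x * f x) = 0"
proof -
  let ?g = "std_normal_density"
  have contf: "continuous_on UNIV f"
    using der by (meson DERIV_continuous continuous_at_imp_continuous_on)
  have [measurable]: "f \<in> borel_measurable borel" "f' \<in> borel_measurable borel"
    using contf cont by (auto intro: borel_measurable_continuous_onI)
  have int: "integrable std_normal_distribution (\<lambda>x. f' x - x * f x)"
  proof (intro Bochner_Integration.integrable_diff)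
    show "integrable std_normal_distribution f'"
      by (rule integrable_std_normal_poly_bound[OF _ bd']) simp
    show "integrable std_normal_distribution (\<lambda>x. x * f x)"
      by (rule integrable_std_normal_poly_bound[of _ "[:0, 1:] * p"])
         (auto simp: abs_mult bd intro!: mult_left_mono)
  qed
  have lim: "((\<lambda>x. f x * ?g x) \<longlongrightarrow> 0) F" if "((\<lambda>x. poly p x * ?g x) \<longlongrightarrow> 0) F" for F
    by (rule Lim_null_comparison[OF _ tendsto_rabs_zero[OF that]])
       (auto simp: abs_mult normal_density_nonneg bd intro!: mult_right_mono always_eventually)
  have "(LBINT x=-\<infinity>..\<infinity>. (f' x - x * f x) * ?g x) = 0 - 0"
  proof (rule interval_integral_FTC_integrable[where F = "\<lambda>x. f x * ?g x"])
    show "((\<lambda>x. f x * ?g x) has_vector_derivative (f' x - x * f x) * ?g x) (at x)" for x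
      unfolding has_real_derivative_iff_has_vector_derivative[symmetric]
      by (rule derivative_eq_intros der std_normal_density_has_derivative refl)+ (simp add: algebra_simps)
    show "isCont (\<lambda>x. (f' x - x * f x) * ?g x) x" for x
      using cont contf unfolding std_normal_density_def
      by (intro continuous_intros) (auto simp: continuous_on_eq_continuous_at)
    show "set_integrable lborel (einterval (-\<infinity>) \<infinity>) (\<lambda>x. (f' x - x * f x) * ?g x)"
      using int by (simp add: set_integrable_def integrable_density normal_density_nonneg mult.commute)
    show "(((\<lambda>x. f x * ?g x) \<circ> real_of_ereal) \<longlongrightarrow> 0) (at_right (-\<infinity>))"
      unfolding ereal_tendsto_simps by (intro lim poly_times_std_normal_density_tendsto_0_bot)
    show "(((\<lambda>x. f x * ?g x) \<circ> real_of_ereal) \<longlongrightarrow> 0) (at_left \<infinity>)"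
      unfolding ereal_tendsto_simps by (intro lim poly_times_std_normal_density_tendsto_0_top)
  qed simp
  then show ?thesis
    by (simp add: interval_lebesgue_integral_def set_lebesgue_integral_def integral_density
        normal_density_nonneg mult.commute)
qed

text \<open>The witness is the \<open>k\<close>th Hermite polynomial: \<open>x * q - q'\<close> is
  the Gaussian adjoint of differentiation applied to \<open>q\<close>, iterated from the constant 1.
  For \<open>degree p \<le> k\<close> the right side is the constant
  \<open>fact k * coeff p k\<close>, so the coefficient of degree \<open>k\<close> becomes a
  Gaussian inner product.\<close>

lemma hermite_like_poly_exists:
  "\<exists>q::real poly. \<forall>p. gauss_int (\<lambda>x. poly p x * poly q x) = gauss_int (poly ((pderiv ^^ k) p))"
proof (induction k)
  case 0
  show ?case by (intro exI[of _ 1]) simp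
next
  case (Suc k)
  then obtain q where q: "\<And>p. gauss_int (\<lambda>x. poly p x * poly q x) = gauss_int (poly ((pderiv ^^ k) p))"
    by blast
  have "gauss_int (\<lambda>x. poly p x * poly ([:0,1:] * q - pderiv q) x) = gauss_int (poly ((pderiv ^^ Suc k) p))" for p
  proof -
    have "gauss_int (\<lambda>x. poly (pderiv (p * q)) x - x * poly (p * q) x) = 0"
      by (rule gaussian_integration_by_parts[where p = "p * q" and q = "pderiv (p * q)"])
         (auto intro!: continuous_intros simp: poly_DERIV simp del: poly_mult)
    moreover have "(\<lambda>x. poly (pderiv (p * q)) x - x * poly (p * q) x) =
        (\<lambda>x. poly (pderiv p * q) x - poly (p * ([:0,1:] * q - pderiv q)) x)"
      by (auto simp: pderiv_mult algebra_simps)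
    ultimately have "gauss_int (poly (p * ([:0,1:] * q - pderiv q))) = gauss_int (poly (pderiv p * q))"
      by (simp only:) (subst (asm) Bochner_Integration.integral_diff, auto intro: integrable_std_normal_poly)
    also have "poly (pderiv p * q) = (\<lambda>x. poly (pderiv p) x * poly q x)" by auto
    also have "gauss_int \<dots> = gauss_int (poly ((pderiv ^^ k) (pderiv p)))"
      by (rule q)
    finally have "gauss_int (poly (p * ([:0,1:] * q - pderiv q))) = gauss_int (poly ((pderiv ^^ Suc k) p))"
      by (simp only: funpow_Suc_right o_apply)
    moreover have "poly (p * ([:0,1:] * q - pderiv q)) = (\<lambda>x. poly p x * poly ([:0,1:] * q - pderiv q) x)"
      by auto
    ultimately show ?thesis by (simp only:)
  qed
  then show ?case by blast
qed

section \<open>Size of a polynomial under the Gaussian law: norm inequalities and small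
  values\<close>

definition gauss_sq :: "real poly \<Rightarrow> real" where
  "gauss_sq p = gauss_int (\<lambda>x. (poly p x)\<^sup>2)"

lemma integrable_std_normal_poly_square:
  "integrable std_normal_distribution (\<lambda>x. (poly p x)\<^sup>2)"
  using integrable_std_normal_poly[of "p ^ 2"] by (simp add: poly_power[abs_def])

lemma integrable_std_normal_poly_mult:
  "integrable std_normal_distribution (\<lambda>x. poly p x * poly q x)"
  using integrable_std_normal_poly[of "p * q"] by (simp add: poly_mult[abs_def])

lemma gauss_sq_nonneg: "gauss_sq p \<ge> 0"
  unfolding gauss_sq_def by (rule Bochner_Integration.integral_nonneg) simp

lemma gauss_sq_add: "gauss_sq (p + q) \<le> 2 * gauss_sq p + 2 * gauss_sq q"
proof -
  have "gauss_sq (p + q) \<le> gauss_int (\<lambda>x. 2 * (poly p x)\<^sup>2 + 2 * (poly q x)\<^sup>2)"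
    unfolding gauss_sq_def
  proof (rule integral_mono)
    show "(poly (p + q) x)\<^sup>2 \<le> 2 * (poly p x)\<^sup>2 + 2 * (poly q x)\<^sup>2" for x
      using zero_le_power2[of "poly p x - poly q x"] by (simp add: power2_eq_square algebra_simps)
  qed (auto intro!: integrable_std_normal_poly_square simp del: poly_add)
  also have "\<dots> = 2 * gauss_sq p + 2 * gauss_sq q"
    unfolding gauss_sq_def
    by (subst Bochner_Integration.integral_add) (auto intro!: integrable_std_normal_poly_square)
  finally show ?thesis .
qed

lemma gauss_sq_smult: "gauss_sq (smult a p) = a\<^sup>2 * gauss_sq p"
  unfolding gauss_sq_def by (simp add: power_mult_distrib)

text \<open>Cauchy-Schwarz, with 1 added to \<open>gauss_sq q\<close> so that the divisor
  \<open>b\<close> is positive for every \<open>q\<close>. The number \<open>s = y / b\<close>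
  minimises \<open>gauss_sq p - 2 * s * y + s\<^sup>2 * b\<close>.\<close>

lemma gauss_int_poly_mult_square_le:
  "(gauss_int (\<lambda>x. poly p x * poly q x))\<^sup>2 \<le> (gauss_sq q + 1) * gauss_sq p"
proof -
  define y where "y = gauss_int (\<lambda>x. poly p x * poly q x)"
  define b where "b = gauss_sq q + 1"
  define s where "s = y / b"
  have b: "b \<ge> 1" using gauss_sq_nonneg[of q] by (simp add: b_def)
  have "2 * s * y = gauss_int (\<lambda>x. 2 * s * (poly p x * poly q x))"
    unfolding y_def by simp
  also have "\<dots> \<le> gauss_int (\<lambda>x. (poly p x)\<^sup>2 + s\<^sup>2 * (poly q x)\<^sup>2)"
  proof (rule integral_mono)
    show "2 * s * (poly p x * poly q x) \<le> (poly p x)\<^sup>2 + s\<^sup>2 * (poly q x)\<^sup>2" for x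
      using zero_le_power2[of "poly p x - s * poly q x"] by (simp add: power2_eq_square algebra_simps)
  qed (auto intro!: integrable_std_normal_poly_square integrable_std_normal_poly_mult)
  also have "\<dots> = gauss_sq p + s\<^sup>2 * gauss_sq q"
    unfolding gauss_sq_def
    by (subst Bochner_Integration.integral_add) (auto intro!: integrable_std_normal_poly_square)
  also have "\<dots> \<le> gauss_sq p + s\<^sup>2 * b" by (simp add: b_def mult_left_mono)
  finally have "2 * s * y \<le> gauss_sq p + s\<^sup>2 * b" .
  moreover have "y = s * b" using b by (simp add: s_def)
  ultimately have "s\<^sup>2 * b \<le> gauss_sq p" by (simp add: power2_eq_square algebra_simps)
  then have "b * (s\<^sup>2 * b) \<le> b * gauss_sq p" using b by (intro mult_left_mono) auto
  then show ?thesis unfolding y_def[symmetric] b_def[symmetric] \<open>y = s * b\<close>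
    by (simp add: power2_eq_square algebra_simps)
qed

lemma pderiv_funpow_degree:
  fixes p :: "real poly"
  assumes "degree p \<le> k"
  shows "(pderiv ^^ k) p = [:fact k * coeff p k:]"
proof (rule poly_eqI)
  fix n
  show "coeff ((pderiv ^^ k) p) n = coeff [:fact k * coeff p k:] n"
    using assms by (cases n) (auto simp: coeff_higher_pderiv coeff_eq_0 pochhammer_fact)
qed

text \<open>Pairing \<open>p\<close> with the polynomial of \<open>hermite_like_poly_exists\<close>
  isolates \<open>fact k * coeff p k\<close>; Cauchy-Schwarz does the rest.\<close>

lemma coeff_square_le_gauss_sq:
  "\<exists>C\<ge>0. \<forall>p. degree p \<le> k \<longrightarrow> (coeff p k)\<^sup>2 \<le> C * gauss_sq p"
proof -
  obtain q :: "real poly" where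
    q: "\<And>p. gauss_int (\<lambda>x. poly p x * poly q x) = gauss_int (poly ((pderiv ^^ k) p))"
    using hermite_like_poly_exists by blast
  interpret prob_space std_normal_distribution by (rule prob_space_std_normal)
  have "(coeff p k)\<^sup>2 \<le> (gauss_sq q + 1) * gauss_sq p" if "degree p \<le> k" for p
  proof -
    have c: "gauss_int (\<lambda>x. poly p x * poly q x) = fact k * coeff p k"
      using that prob_space unfolding q by (simp add: pderiv_funpow_degree poly_pCons[abs_def])
    have "(coeff p k)\<^sup>2 \<le> (fact k * coeff p k)\<^sup>2"
      unfolding abs_le_square_iff[symmetric] abs_mult
      using fact_ge_1[of k, where ?'a = real] by (simp add: mult_le_cancel_right1)
    also have "\<dots> \<le> (gauss_sq q + 1) * gauss_sq p"
      using gauss_int_poly_mult_square_le[of p q] by (simp add: c)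
    finally show ?thesis .
  qed
  then show ?thesis using gauss_sq_nonneg[of q] by (intro exI[of _ "gauss_sq q + 1"]) auto
qed

text \<open>An instance of the equivalence of norms in finite dimension, with the constant built by
  induction: the top monomial is split off, its coefficient is controlled by
  \<open>coeff_square_le_gauss_sq\<close>, and the remainder \<open>q\<close> has smaller
  degree.\<close>

lemma gauss_sq_pderiv_le:
  "\<exists>C\<ge>0. \<forall>p. degree p \<le> d \<longrightarrow> gauss_sq (pderiv p) \<le> C * gauss_sq p"
proof (induction d)
  case 0
  show ?case
    by (intro exI[of _ 0]) (auto elim!: degree_eq_zeroE simp: gauss_sq_def)
next
  case (Suc d)
  then obtain C where C: "C \<ge> 0" "\<And>p. degree p \<le> d \<Longrightarrow> gauss_sq (pderiv p) \<le> C * gauss_sq p"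
    by blast
  obtain B where B: "B \<ge> 0" "\<And>p. degree p \<le> Suc d \<Longrightarrow> (coeff p (Suc d))\<^sup>2 \<le> B * gauss_sq p"
    using coeff_square_le_gauss_sq by blast
  define m :: "real poly" where "m = monom 1 (Suc d)"
  define K where "K = 2 * (B * gauss_sq (pderiv m)) + 2 * C * (2 + 2 * (B * gauss_sq m))"
  have "gauss_sq (pderiv p) \<le> K * gauss_sq p" if p: "degree p \<le> Suc d" for p
  proof -
    define a where "a = coeff p (Suc d)"
    define q where "q = p + smult (-a) m"
    have a: "a\<^sup>2 \<le> B * gauss_sq p" using B p by (simp add: a_def)
    have "degree q \<le> d"
    proof (rule degree_le, intro allI impI)
      fix i assume "d < i"
      then show "coeff q i = 0" using p
        by (cases "i = Suc d") (auto simp: q_def m_def a_def coeff_eq_0)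
    qed
    have "gauss_sq q \<le> 2 * gauss_sq p + 2 * (a\<^sup>2 * gauss_sq m)"
      unfolding q_def using gauss_sq_add[of p "smult (-a) m"] by (simp only: gauss_sq_smult power2_minus)
    also have "\<dots> \<le> 2 * gauss_sq p + 2 * (B * gauss_sq p * gauss_sq m)"
      using a by (simp add: gauss_sq_nonneg mult_right_mono)
    finally have q: "gauss_sq q \<le> (2 + 2 * (B * gauss_sq m)) * gauss_sq p" by (simp add: algebra_simps)
    have "p = smult a m + q" by (simp add: q_def)
    then have "pderiv p = smult a (pderiv m) + pderiv q" by (simp add: pderiv_add pderiv_smult)
    then have "gauss_sq (pderiv p) \<le> 2 * (a\<^sup>2 * gauss_sq (pderiv m)) + 2 * gauss_sq (pderiv q)"
      using gauss_sq_add[of "smult a (pderiv m)" "pderiv q"] by (simp only: gauss_sq_smult)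
    also have "\<dots> \<le> 2 * (B * gauss_sq p * gauss_sq (pderiv m)) + 2 * (C * gauss_sq q)"
      using a C(2)[OF \<open>degree q \<le> d\<close>] by (intro add_mono mult_left_mono mult_right_mono gauss_sq_nonneg) auto
    also have "\<dots> \<le> 2 * (B * gauss_sq p * gauss_sq (pderiv m)) + 2 * (C * ((2 + 2 * (B * gauss_sq m)) * gauss_sq p))"
      using q C(1) by (intro add_mono[OF order_refl] mult_left_mono) auto
    also have "\<dots> = K * gauss_sq p" by (simp add: K_def algebra_simps)
    finally show ?thesis .
  qed
  moreover have "K \<ge> 0" unfolding K_def using B(1) C(1) by (intro add_nonneg_nonneg mult_nonneg_nonneg gauss_sq_nonneg) auto
  ultimately show ?case by blast
qed

text \<open>Over the complex numbers \<open>p\<close> is its leading coefficient times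
  \<open>degree p\<close> linear factors, and for real \<open>x\<close> the distance to a root is at
  least the distance to its real part. If all these distances are at least \<open>s\<close>, so is
  every factor. The centres \<open>r\<close> serve all \<open>s\<close> at once.\<close>

lemma poly_sublevel_near_roots:
  fixes p :: "real poly"
  shows "\<exists>r. \<forall>x s. \<bar>poly p x\<bar> < \<bar>lead_coeff p\<bar> * s ^ degree p \<longrightarrow> s > 0 \<longrightarrow>
    (\<exists>i<degree p. \<bar>x - r i\<bar> < s)"
proof -
  define P where "P = map_poly complex_of_real p"
  have deg: "degree P = degree p" and lc: "lead_coeff P = complex_of_real (lead_coeff p)"
    by (simp_all add: P_def degree_map_poly coeff_map_poly)
  obtain z where z: "smult (lead_coeff P) (\<Prod>i<degree P. [:- z i, 1:]) = P"
    using complex_poly_decompose' by blast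
  have abs_p: "\<bar>poly p x\<bar> = \<bar>lead_coeff p\<bar> * (\<Prod>i<degree p. cmod (of_real x - z i))" for x
  proof -
    have "complex_of_real (poly p x) = poly P (of_real x)"
      by (simp add: P_def poly_altdef degree_map_poly coeff_map_poly)
    also have "\<dots> = of_real (lead_coeff p) * (\<Prod>i<degree p. of_real x - z i)"
      by (subst z[symmetric]) (simp add: poly_prod deg lc[unfolded deg])
    finally have "cmod (complex_of_real (poly p x)) = \<bar>lead_coeff p\<bar> * (\<Prod>i<degree p. cmod (of_real x - z i))"
      by (simp add: norm_mult prod_norm)
    then show ?thesis by simp
  qed
  show ?thesis
  proof (intro exI[of _ "\<lambda>i. Re (z i)"] allI impI)
    fix x s :: real
    assume lt: "\<bar>poly p x\<bar> < \<bar>lead_coeff p\<bar> * s ^ degree p" and s: "s > 0"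
    show "\<exists>i<degree p. \<bar>x - Re (z i)\<bar> < s"
    proof (rule ccontr)
      assume "\<not> ?thesis"
      then have "s \<le> \<bar>x - Re (z i)\<bar>" if "i < degree p" for i using that by (meson not_le)
      moreover have "\<bar>x - Re (z i)\<bar> \<le> cmod (of_real x - z i)" for i
        using abs_Re_le_cmod[of "of_real x - z i"] by simp
      ultimately have "(\<Prod>i<degree p. s) \<le> (\<Prod>i<degree p. cmod (of_real x - z i))"
        using s by (intro prod_mono) (auto intro: order_trans)
      then have "\<bar>lead_coeff p\<bar> * s ^ degree p \<le> \<bar>poly p x\<bar>"
        by (simp add: abs_p mult_left_mono)
      then show False using lt by simp
    qed
  qed
qed

lemma std_normal_measure_ball_le:
  assumes "s > 0"
  shows "measure std_normal_distribution (ball r s) \<le> 2 * s"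
proof -
  have "emeasure std_normal_distribution (ball r s)
      = (\<integral>\<^sup>+x. ennreal (std_normal_density x) * indicator (ball r s) x \<partial>lborel)"
    by (subst emeasure_density) auto
  also have "\<dots> \<le> (\<integral>\<^sup>+x. indicator (ball r s) x \<partial>lborel)"
    by (intro nn_integral_mono) (auto split: split_indicator simp: std_normal_density_le_1)
  also have "\<dots> = ennreal (2 * s)"
    using assms by (simp add: ball_eq_greaterThanLessThan)
  finally show ?thesis using assms by (simp add: measure_def enn2real_leI)
qed

text \<open>The integrand is at most 1 on the balls around the centres, each of measure at most
  \<open>2 * s\<close> since the density is at most 1, and at most \<open>eps / A\<close>
  elsewhere.\<close>

lemma gauss_int_small_poly_le:
  fixes p :: "real poly" and s eps :: real
  assumes lc: "lead_coeff p \<noteq> 0" and s: "s > 0" and eps: "eps > 0"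
  shows "gauss_int (\<lambda>x. eps / ((poly p x)\<^sup>2 + eps)) \<le> 2 * degree p * s + eps / (lead_coeff p * s ^ degree p)\<^sup>2"
proof -
  interpret prob_space std_normal_distribution by (rule prob_space_std_normal)
  define A where "A = (lead_coeff p * s ^ degree p)\<^sup>2"
  have A: "A > 0" using lc s by (simp add: A_def)
  obtain r where r: "\<And>x s. \<bar>poly p x\<bar> < \<bar>lead_coeff p\<bar> * s ^ degree p \<Longrightarrow> s > 0 \<Longrightarrow> \<exists>i<degree p. \<bar>x - r i\<bar> < s"
    using poly_sublevel_near_roots[of p] by blast
  have int: "integrable std_normal_distribution (\<lambda>x. \<Sum>i<degree p. indicat_real (ball (r i) s) x)"
    by (intro Bochner_Integration.integrable_sum) (simp add: emeasure_eq_measure)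
  have "gauss_int (\<lambda>x. eps / ((poly p x)\<^sup>2 + eps))
     \<le> gauss_int (\<lambda>x. (\<Sum>i<degree p. indicat_real (ball (r i) s) x) + eps / A)"
  proof (rule integral_mono)
    show "integrable std_normal_distribution (\<lambda>x. eps / ((poly p x)\<^sup>2 + eps))"
      by (rule integrable_const_bound[where B = 1]) (use eps in \<open>auto simp: divide_le_eq add_nonneg_pos\<close>)
    show "integrable std_normal_distribution (\<lambda>x. (\<Sum>i<degree p. indicat_real (ball (r i) s) x) + eps / A)"
      using int by simp
    fix x
    show "eps / ((poly p x)\<^sup>2 + eps) \<le> (\<Sum>i<degree p. indicat_real (ball (r i) s) x) + eps / A"
    proof (cases "\<bar>poly p x\<bar> < \<bar>lead_coeff p\<bar> * s ^ degree p")
      case True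
      then obtain i where i: "i < degree p" "\<bar>x - r i\<bar> < s" using r s by blast
      have "eps / ((poly p x)\<^sup>2 + eps) \<le> 1" using eps by (simp add: divide_le_eq add_nonneg_pos)
      also have "1 = indicat_real (ball (r i) s) x"
        using i by (simp add: dist_real_def abs_minus_commute)
      also have "\<dots> \<le> (\<Sum>i<degree p. indicat_real (ball (r i) s) x)"
        using i by (intro member_le_sum) auto
      finally show ?thesis using eps A by (simp add: add_increasing2)
    next
      case False
      then have "\<bar>lead_coeff p * s ^ degree p\<bar> \<le> \<bar>poly p x\<bar>" using s by (simp add: abs_mult)
      then have "A \<le> (poly p x)\<^sup>2" unfolding A_def by (simp add: abs_le_square_iff)
      then have "eps / ((poly p x)\<^sup>2 + eps) \<le> eps / A" using eps A by (intro divide_left_mono) auto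
      then show ?thesis by (simp add: add_increasing sum_nonneg)
    qed
  qed
  also have "\<dots> = (\<Sum>i<degree p. measure std_normal_distribution (ball (r i) s)) + eps / A"
    using int prob_space by (simp add: emeasure_eq_measure)
  also have "\<dots> \<le> (\<Sum>i<degree p. 2 * s) + eps / A"
    by (intro add_mono sum_mono std_normal_measure_ball_le s) auto
  finally show ?thesis by (simp add: A_def algebra_simps)
qed

section \<open>Comparison of the laws of two polynomials\<close>

lemma abs_le_1_plus_square: "\<bar>u\<bar> \<le> 1 + u\<^sup>2" for u :: real
  using zero_le_power2[of "\<bar>u\<bar> - 1"] by (simp add: power2_eq_square algebra_simps)

lemma abs_mult_le_sum_squares: "\<bar>a\<bar> * \<bar>b\<bar> \<le> a\<^sup>2 + b\<^sup>2" for a b :: real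
proof -
  have "2 * (\<bar>a\<bar> * \<bar>b\<bar>) \<le> a\<^sup>2 + b\<^sup>2"
    using zero_le_power2[of "\<bar>a\<bar> - \<bar>b\<bar>"] by (simp add: power2_diff)
  moreover have "0 \<le> \<bar>a\<bar> * \<bar>b\<bar>" by simp
  ultimately show ?thesis by linarith
qed

text \<open>\<open>P\<close> and \<open>Q\<close> enter asymmetrically: the first term depends on
  \<open>P\<close> alone and is small when \<open>pderiv P\<close> is rarely near 0, the second is
  of first order in \<open>P - Q\<close>. The antiderivative of \<open>\<phi>\<close> is
  1-Lipschitz, and this is what turns \<open>\<Phi>(P) - \<Phi>(Q)\<close> into
  \<open>\<bar>P - Q\<bar>\<close>.\<close>

lemma gauss_int_test_function_diff_le:
  fixes \<phi> :: "real \<Rightarrow> real" and P Q :: "real poly"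
  assumes cont: "continuous_on UNIV \<phi>" and bd: "\<And>x. \<bar>\<phi> x\<bar> \<le> 1" and e: "0 < \<epsilon>" "\<epsilon> \<le> 1"
  shows "\<bar>gauss_int (\<lambda>x. \<phi> (poly P x) - \<phi> (poly Q x))\<bar>
     \<le> 2 * gauss_int (\<lambda>x. \<epsilon> / ((poly (pderiv P) x)\<^sup>2 + \<epsilon>))
       + 1 / \<epsilon> * gauss_int (\<lambda>x. \<bar>poly (pderiv (P - Q)) x\<bar>
            + \<bar>poly (P - Q) x\<bar> * (\<bar>poly (pderiv (pderiv P)) x\<bar> + \<bar>x\<bar>))"
proof -
  interpret prob_space std_normal_distribution by (rule prob_space_std_normal)
  obtain \<Phi> where \<Phi>: "\<And>x. (\<Phi> has_real_derivative \<phi> x) (at x)"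
    using einterval_antiderivative[of "-\<infinity>" \<infinity> \<phi>] cont
    by (auto simp: has_real_derivative_iff_has_vector_derivative continuous_on_eq_continuous_at)
  have lip: "\<bar>\<Phi> x - \<Phi> y\<bar> \<le> \<bar>x - y\<bar>" for x y
    using field_differentiable_bound[of UNIV \<Phi> \<phi> 1 x y] \<Phi> bd by simp
  have contP: "continuous_on UNIV \<Phi>"
    using \<Phi> by (meson DERIV_continuous continuous_at_imp_continuous_on)
  \<comment> \<open>Integrate by parts \<open>(\<Phi>(P) - \<Phi>(Q)) P' / (P'\<^sup>2 + \<epsilon>)\<close>: its derivative contains
    \<open>\<phi>(P) - \<phi>(Q)\<close> up to terms that are small or weighted by \<open>\<epsilon> / (P'\<^sup>2 + \<epsilon>)\<close>.\<close>
  define P1 P2 Q1 D where "P1 = poly (pderiv P)" and "P2 = poly (pderiv (pderiv P))"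
    and "Q1 = poly (pderiv Q)" and "D = (\<lambda>x. poly P x - poly Q x)"
  define w where "w x = P1 x / ((P1 x)\<^sup>2 + \<epsilon>)" for x
  define w' where "w' x = P2 x * (\<epsilon> - (P1 x)\<^sup>2) / ((P1 x)\<^sup>2 + \<epsilon>)\<^sup>2" for x
  define f where "f x = (\<Phi> (poly P x) - \<Phi> (poly Q x)) * w x" for x
  define f' where "f' x = (\<phi> (poly P x) * P1 x - \<phi> (poly Q x) * Q1 x) * w x
      + (\<Phi> (poly P x) - \<Phi> (poly Q x)) * w' x" for x
  have pos: "(P1 x)\<^sup>2 + \<epsilon> > 0" for x using e by (simp add: add_nonneg_pos)
  have derP: "(P1 has_real_derivative P2 x) (at x)" for x unfolding P1_def P2_def by (rule poly_DERIV)
  have contpoly: "continuous_on UNIV P1" "continuous_on UNIV P2" "continuous_on UNIV Q1"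
    unfolding P1_def P2_def Q1_def by (auto intro!: continuous_intros)
  have cont_comp: "continuous_on UNIV (\<lambda>x. \<phi> (poly p x))" "continuous_on UNIV (\<lambda>x. \<Phi> (poly p x))" for p
    by (auto intro!: continuous_on_compose2[OF cont] continuous_on_compose2[OF contP] continuous_intros)
  have [measurable]: "P1 \<in> borel_measurable borel" "P2 \<in> borel_measurable borel"
      "Q1 \<in> borel_measurable borel" "\<phi> \<in> borel_measurable borel"
    using contpoly cont by (auto intro: borel_measurable_continuous_onI)
  \<comment> \<open>Coarser than the optimal \<open>1 / (2 * sqrt \<epsilon>)\<close>, but
    \<open>w'\<close> costs a factor \<open>1 / \<epsilon>\<close> in any case: its bound is
    attained where \<open>P1\<close> vanishes.\<close>
  have w_bd: "\<bar>w x\<bar> \<le> 1 / \<epsilon>" for x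
  proof -
    have "\<bar>P1 x\<bar> \<le> 1 + (P1 x)\<^sup>2" by (rule abs_le_1_plus_square)
    then have "\<epsilon> * \<bar>P1 x\<bar> \<le> \<epsilon> * (1 + (P1 x)\<^sup>2)" using e by (simp add: mult_left_mono)
    also have "\<dots> \<le> \<epsilon> + (P1 x)\<^sup>2" using e mult_right_mono[of \<epsilon> 1 "(P1 x)\<^sup>2"] by (simp add: algebra_simps)
    finally show ?thesis using e pos[of x] unfolding w_def by (simp add: abs_div field_simps)
  qed
  have w'_bd: "\<bar>w' x\<bar> \<le> \<bar>P2 x\<bar> / \<epsilon>" for x
  proof -
    let ?A = "(P1 x)\<^sup>2 + \<epsilon>"
    have "\<bar>\<epsilon> - (P1 x)\<^sup>2\<bar> \<le> ?A" using e zero_le_power2[of "P1 x"] by linarith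
    then have "\<bar>w' x\<bar> \<le> \<bar>P2 x\<bar> * ?A / ?A\<^sup>2"
      unfolding w'_def using pos[of x] by (simp add: abs_mult divide_right_mono mult_left_mono)
    also have "\<dots> = \<bar>P2 x\<bar> / ?A" using pos[of x] by (simp add: power2_eq_square)
    also have "\<dots> \<le> \<bar>P2 x\<bar> / \<epsilon>" using e pos[of x] by (intro divide_left_mono) auto
    finally show ?thesis .
  qed
  have w_der: "(w has_real_derivative w' x) (at x)" for x
    unfolding w_def w'_def using pos[of x]
    by (auto intro!: derivative_eq_intros derP simp: power2_eq_square field_simps)
  have der: "(f has_real_derivative f' x) (at x)" for x
    unfolding f_def f'_def P1_def Q1_def
    by (rule derivative_eq_intros DERIV_chain2[OF \<Phi>] poly_DERIV w_der refl)+ simp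
  have cont_w: "continuous_on UNIV w" "continuous_on UNIV w'"
    unfolding w_def w'_def using pos by (auto intro!: continuous_intros contpoly simp: less_imp_neq[symmetric])
  have contf': "continuous_on UNIV f'"
    unfolding f'_def by (intro continuous_intros cont_comp contpoly cont_w)
  have Phi_bd: "\<bar>\<Phi> (poly P x) - \<Phi> (poly Q x)\<bar> \<le> \<bar>D x\<bar>" for x
    using lip by (simp add: D_def)
  have f_bd: "\<bar>f x\<bar> \<le> \<bar>poly (smult (1/\<epsilon>) (P - Q)) x\<bar>" for x
  proof -
    have "\<bar>f x\<bar> \<le> \<bar>D x\<bar> * (1 / \<epsilon>)"
      unfolding f_def abs_mult using e by (intro mult_mono Phi_bd w_bd) auto
    then show ?thesis using e by (simp add: D_def abs_mult abs_div)
  qed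
  \<comment> \<open>Integrability is proved by polynomial domination, so absolute values are
    replaced using \<open>\<bar>u\<bar> \<le> 1 + u\<^sup>2\<close> and
    \<open>\<bar>a\<bar> * \<bar>b\<bar> \<le> a\<^sup>2 + b\<^sup>2\<close>.\<close>
  define B where "B = smult (1/\<epsilon>) (2 + (pderiv P)\<^sup>2 + (pderiv Q)\<^sup>2 + (P - Q)\<^sup>2 + (pderiv (pderiv P))\<^sup>2)"
  have f'_bd: "\<bar>f' x\<bar> \<le> \<bar>poly B x\<bar>" for x
  proof -
    have "\<bar>\<phi> (poly P x) * P1 x - \<phi> (poly Q x) * Q1 x\<bar> \<le> \<bar>P1 x\<bar> + \<bar>Q1 x\<bar>"
      using mult_right_mono[OF bd[of "poly P x"], of "\<bar>P1 x\<bar>"] mult_right_mono[OF bd[of "poly Q x"], of "\<bar>Q1 x\<bar>"]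
      by (simp add: abs_mult[symmetric])
    then have "\<bar>f' x\<bar> \<le> (\<bar>P1 x\<bar> + \<bar>Q1 x\<bar>) * (1 / \<epsilon>) + \<bar>D x\<bar> * (\<bar>P2 x\<bar> / \<epsilon>)"
      unfolding f'_def using e
      by (intro order_trans[OF abs_triangle_ineq] add_mono) (auto simp only: abs_mult intro!: mult_mono w_bd w'_bd Phi_bd)
    also have "\<dots> = 1 / \<epsilon> * (\<bar>P1 x\<bar> + \<bar>Q1 x\<bar> + \<bar>D x\<bar> * \<bar>P2 x\<bar>)"
      by (simp add: add_divide_distrib distrib_left)
    also have "\<dots> \<le> 1 / \<epsilon> * ((1 + (P1 x)\<^sup>2) + (1 + (Q1 x)\<^sup>2) + ((D x)\<^sup>2 + (P2 x)\<^sup>2))"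
      using e by (intro mult_left_mono add_mono abs_le_1_plus_square abs_mult_le_sum_squares) auto
    also have "\<dots> = poly B x" unfolding B_def P1_def P2_def Q1_def D_def by simp
    finally show ?thesis by simp
  qed
  have ibp: "gauss_int (\<lambda>x. f' x - x * f x) = 0"
    by (rule gaussian_integration_by_parts[OF der contf' f_bd f'_bd])
  have [measurable]: "f \<in> borel_measurable borel" "f' \<in> borel_measurable borel"
    using contf' der by (auto intro!: borel_measurable_continuous_onI continuous_at_imp_continuous_on DERIV_continuous)
  have int_f: "integrable std_normal_distribution (\<lambda>x. f' x - x * f x)"
  proof (intro Bochner_Integration.integrable_diff)
    show "integrable std_normal_distribution f'"
      by (rule integrable_std_normal_poly_bound[OF _ f'_bd]) simp
    show "integrable std_normal_distribution (\<lambda>x. x * f x)"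
      by (rule integrable_std_normal_poly_bound[of _ "[:0, 1:] * smult (1/\<epsilon>) (P - Q)"])
         (use f_bd in \<open>auto simp: abs_mult intro!: mult_left_mono simp flip: times_divide_eq_right\<close>)
  qed
  have int_phi: "integrable std_normal_distribution (\<lambda>x. \<phi> (poly P x) - \<phi> (poly Q x))"
    by (intro Bochner_Integration.integrable_diff; rule integrable_const_bound[where B = 1])
       (auto simp: bd intro!: measurable_compose[OF _ borel_measurable_continuous_onI[OF cont]] borel_measurable_continuous_onI continuous_intros)
  let ?R1 = "\<lambda>x. \<epsilon> / ((P1 x)\<^sup>2 + \<epsilon>)"
  let ?R2 = "\<lambda>x. \<bar>P1 x - Q1 x\<bar> + \<bar>D x\<bar> * (\<bar>P2 x\<bar> + \<bar>x\<bar>)"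
  have int1: "integrable std_normal_distribution ?R1"
    by (rule integrable_const_bound[where B = 1]) (use e pos in \<open>auto simp: divide_le_eq\<close>)
  have int2: "integrable std_normal_distribution ?R2"
  proof (rule integrable_std_normal_poly_bound[where p = "2 + (pderiv P - pderiv Q)\<^sup>2 + (P - Q)\<^sup>2 + (pderiv (pderiv P))\<^sup>2 + (P - Q)\<^sup>2 + [:0,1:]\<^sup>2"])
    fix x
    have "?R2 x = \<bar>P1 x - Q1 x\<bar> + (\<bar>D x\<bar> * \<bar>P2 x\<bar> + \<bar>D x\<bar> * \<bar>x\<bar>)" by (simp add: distrib_left)
    also have "\<dots> \<le> (1 + (P1 x - Q1 x)\<^sup>2) + (((D x)\<^sup>2 + (P2 x)\<^sup>2) + ((D x)\<^sup>2 + x\<^sup>2))"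
      by (intro add_mono abs_le_1_plus_square abs_mult_le_sum_squares)
    also have "\<dots> \<le> poly (2 + (pderiv P - pderiv Q)\<^sup>2 + (P - Q)\<^sup>2 + (pderiv (pderiv P))\<^sup>2 + (P - Q)\<^sup>2 + [:0,1:]\<^sup>2) x"
      unfolding P1_def Q1_def D_def P2_def by simp
    finally show "\<bar>?R2 x\<bar> \<le> \<bar>poly (2 + (pderiv P - pderiv Q)\<^sup>2 + (P - Q)\<^sup>2 + (pderiv (pderiv P))\<^sup>2 + (P - Q)\<^sup>2 + [:0,1:]\<^sup>2) x\<bar>"
      by simp
  qed (auto simp: D_def)
  have intR: "integrable std_normal_distribution (\<lambda>x. 2 * ?R1 x + 1 / \<epsilon> * ?R2 x)"
    by (intro Bochner_Integration.integrable_add integrable_mult_right int1 int2)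
  have key: "\<bar>(\<phi> (poly P x) - \<phi> (poly Q x)) - (f' x - x * f x)\<bar> \<le> 2 * ?R1 x + 1 / \<epsilon> * ?R2 x" for x
  proof -
    let ?a = "\<phi> (poly P x)" and ?b = "\<phi> (poly Q x)" and ?d = "\<Phi> (poly P x) - \<Phi> (poly Q x)"
    \<comment> \<open>Writing \<open>Q1\<close> as \<open>P1 - (P1 - Q1)\<close> in
      \<open>f'\<close> gives \<open>?a - ?b\<close> the factor \<open>P1 * w\<close>, which is 1 up
      to \<open>?R1\<close>. The error from this replacement carries \<open>P1 - Q1\<close>.\<close>
    have "P1 x * w x = 1 - ?R1 x" using pos[of x] unfolding w_def by (simp add: power2_eq_square field_simps)
    then have "(?a - ?b) - (f' x - x * f x) = (?a - ?b) * ?R1 x - ?b * (P1 x - Q1 x) * w x - ?d * w' x + x * ?d * w x"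
      unfolding f'_def f_def by algebra
    moreover have tri: "\<bar>u1 - u2 - u3 + u4\<bar> \<le> \<bar>u1\<bar> + \<bar>u2\<bar> + \<bar>u3\<bar> + \<bar>u4\<bar>" for u1 u2 u3 u4 :: real
      by linarith
    ultimately have "\<bar>(?a - ?b) - (f' x - x * f x)\<bar> \<le> \<bar>(?a - ?b) * ?R1 x\<bar> + \<bar>?b * (P1 x - Q1 x) * w x\<bar> + \<bar>?d * w' x\<bar> + \<bar>x * ?d * w x\<bar>"
      by (simp only: tri)
    also have "\<dots> \<le> 2 * ?R1 x + (1 * \<bar>P1 x - Q1 x\<bar>) * (1 / \<epsilon>) + \<bar>D x\<bar> * (\<bar>P2 x\<bar> / \<epsilon>) + (\<bar>x\<bar> * \<bar>D x\<bar>) * (1 / \<epsilon>)"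
    proof (intro add_mono)
      have "\<bar>?a - ?b\<bar> \<le> 2" using bd[of "poly P x"] bd[of "poly Q x"] by linarith
      then show "\<bar>(?a - ?b) * ?R1 x\<bar> \<le> 2 * ?R1 x"
        unfolding abs_mult using e pos[of x] by (intro mult_mono) auto
    qed (use e in \<open>auto simp only: abs_mult intro!: mult_mono bd w_bd w'_bd Phi_bd mult_nonneg_nonneg abs_ge_zero\<close>)
    also have "\<dots> = 2 * ?R1 x + 1 / \<epsilon> * ?R2 x"
      by (simp add: add_divide_distrib distrib_left)
    finally show ?thesis .
  qed
  have "\<bar>gauss_int (\<lambda>x. \<phi> (poly P x) - \<phi> (poly Q x))\<bar>
      = \<bar>gauss_int (\<lambda>x. (\<phi> (poly P x) - \<phi> (poly Q x)) - (f' x - x * f x))\<bar>"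
    using ibp by (simp only: Bochner_Integration.integral_diff[OF int_phi int_f] diff_zero)
  also have "\<dots> \<le> gauss_int (\<lambda>x. 2 * ?R1 x + 1 / \<epsilon> * ?R2 x)"
    by (rule order_trans[OF integral_abs_bound integral_mono])
       (intro integrable_abs Bochner_Integration.integrable_diff[OF int_phi int_f] intR key)+
  also have "\<dots> = 2 * gauss_int ?R1 + 1 / \<epsilon> * gauss_int ?R2"
    by (simp only: Bochner_Integration.integral_add[OF integrable_mult_right[OF int1] integrable_mult_right[OF int2]]
        integral_mult_right_zero)
  finally show ?thesis unfolding P1_def P2_def Q1_def D_def by (simp add: pderiv_diff)
qed

text \<open>Weighted arithmetic-geometric means with a free parameter \<open>\<eta>\<close> stand in
  for Cauchy-Schwarz: without square roots the bound is affine in the values of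
  \<open>gauss_sq\<close>, so it can later be integrated over the conditioning variables.
  \<open>gauss_sq_pderiv_le\<close> then removes the derivatives.\<close>

lemma gauss_int_derivative_terms_le:
  "\<exists>C\<ge>0. \<forall>P Q \<eta>. degree P \<le> k \<longrightarrow> degree Q \<le> k \<longrightarrow> 0 < \<eta> \<longrightarrow>
     gauss_int (\<lambda>x. \<bar>poly (pderiv (P - Q)) x\<bar>
            + \<bar>poly (P - Q) x\<bar> * (\<bar>poly (pderiv (pderiv P)) x\<bar> + \<bar>x\<bar>))
     \<le> C * (gauss_sq (P - Q) / \<eta> + \<eta> * (1 + gauss_sq P))"
proof -
  obtain B where B: "B \<ge> 0" "\<And>p. degree p \<le> k \<Longrightarrow> gauss_sq (pderiv p) \<le> B * gauss_sq p"
    using gauss_sq_pderiv_le by blast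
  interpret prob_space std_normal_distribution by (rule prob_space_std_normal)
  define m where "m = gauss_sq [:0, 1:]"
  have m: "m \<ge> 0" by (simp add: m_def gauss_sq_nonneg)
  define C where "C = 1 + B + B\<^sup>2 + m"
  have "gauss_int (\<lambda>x. \<bar>poly (pderiv (P - Q)) x\<bar>
            + \<bar>poly (P - Q) x\<bar> * (\<bar>poly (pderiv (pderiv P)) x\<bar> + \<bar>x\<bar>))
     \<le> C * (gauss_sq (P - Q) / \<eta> + \<eta> * (1 + gauss_sq P))"
    if dP: "degree P \<le> k" and dQ: "degree Q \<le> k" and \<eta>: "0 < \<eta>" for P Q \<eta>
  proof -
    define D where "D = P - Q"
    define P2 where "P2 = pderiv (pderiv P)"
    have dD: "degree D \<le> k" unfolding D_def using dP dQ by (rule degree_diff_le)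
    have D1: "gauss_sq (pderiv D) \<le> B * gauss_sq D" using B dD by blast
    have "gauss_sq P2 \<le> B * gauss_sq (pderiv P)"
      unfolding P2_def using B(2)[of "pderiv P"] dP by (simp add: degree_pderiv)
    also have "\<dots> \<le> B * (B * gauss_sq P)" using B dP by (intro mult_left_mono) auto
    finally have P2: "gauss_sq P2 \<le> B\<^sup>2 * gauss_sq P" by (simp add: power2_eq_square)
    let ?h = "\<lambda>x. 1/\<eta> * (poly (pderiv D) x)\<^sup>2 + (\<eta> + (1/\<eta> * (poly D x)\<^sup>2 + (\<eta> * (poly P2 x)\<^sup>2 + \<eta> * (poly [:0,1:] x)\<^sup>2)))"
    have int: "integrable std_normal_distribution ?h"
      by (intro Bochner_Integration.integrable_add integrable_mult_right integrable_std_normal_poly_square) simp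
    have "gauss_int (\<lambda>x. \<bar>poly (pderiv D) x\<bar> + \<bar>poly D x\<bar> * (\<bar>poly P2 x\<bar> + \<bar>x\<bar>)) \<le> gauss_int ?h"
    proof (rule Bochner_Integration.integral_mono')
      fix x
      have amgm: "2 * (\<bar>a\<bar> * \<bar>b\<bar>) \<le> 1/\<eta> * a\<^sup>2 + \<eta> * b\<^sup>2" for a b :: real
      proof -
        have "0 \<le> (\<bar>a\<bar> - \<eta> * \<bar>b\<bar>)\<^sup>2 / \<eta>" using \<eta> by simp
        also have "\<dots> = 1/\<eta> * a\<^sup>2 + \<eta> * b\<^sup>2 - 2 * (\<bar>a\<bar> * \<bar>b\<bar>)"
          using \<eta> by (simp add: power2_diff power_mult_distrib field_simps power2_eq_square)
        finally show ?thesis by simp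
      qed
      have "\<bar>poly (pderiv D) x\<bar> \<le> 1/\<eta> * (poly (pderiv D) x)\<^sup>2 + \<eta>"
        using amgm[of "poly (pderiv D) x" 1] by simp
      moreover have "\<bar>poly D x\<bar> * \<bar>poly P2 x\<bar> + \<bar>poly D x\<bar> * \<bar>x\<bar> \<le> 1/\<eta> * (poly D x)\<^sup>2 + (\<eta> * (poly P2 x)\<^sup>2 + \<eta> * x\<^sup>2)"
      proof -
        have "0 \<le> \<eta> * (poly P2 x)\<^sup>2" "0 \<le> \<eta> * x\<^sup>2" using \<eta> by auto
        then show ?thesis using amgm[of "poly D x" "poly P2 x"] amgm[of "poly D x" x] by linarith
      qed
      ultimately show "\<bar>poly (pderiv D) x\<bar> + \<bar>poly D x\<bar> * (\<bar>poly P2 x\<bar> + \<bar>x\<bar>) \<le> ?h x"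
        by (simp add: distrib_left)
    qed (use int \<eta> in \<open>auto intro!: add_nonneg_nonneg mult_nonneg_nonneg\<close>)
    also have "\<dots> = 1/\<eta> * gauss_sq (pderiv D) + (\<eta> + (1/\<eta> * gauss_sq D + (\<eta> * gauss_sq P2 + \<eta> * m)))"
      unfolding gauss_sq_def m_def
      using prob_space
      by (simp add: integrable_std_normal_poly_square integrable_std_normal_distribution_moment)
    also have "\<dots> \<le> 1/\<eta> * (B * gauss_sq D) + (\<eta> + (1/\<eta> * gauss_sq D + (\<eta> * (B\<^sup>2 * gauss_sq P) + \<eta> * m)))"
      using D1 P2 \<eta> by (intro add_mono mult_left_mono) auto
    also have "\<dots> = (B + 1) * (gauss_sq D / \<eta>) + \<eta> * (1 + m) + \<eta> * (B\<^sup>2 * gauss_sq P)"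
      by (simp add: algebra_simps add_divide_distrib)
    also have "\<dots> \<le> C * (gauss_sq D / \<eta>) + \<eta> * C + \<eta> * (C * gauss_sq P)"
    proof -
      have "B + 1 \<le> C" "1 + m \<le> C" "B\<^sup>2 \<le> C" using B(1) m by (auto simp: C_def)
      then show ?thesis using \<eta>
        by (intro add_mono[OF add_mono] mult_left_mono mult_right_mono gauss_sq_nonneg divide_nonneg_pos) auto
    qed
    also have "\<dots> = C * (gauss_sq D / \<eta> + \<eta> * (1 + gauss_sq P))" by (simp add: algebra_simps)
    finally show ?thesis unfolding D_def P2_def .
  qed
  moreover have "C \<ge> 0" using B(1) m by (simp add: C_def)
  ultimately show ?thesis by blast
qed

text \<open>The powers of \<open>s\<close> are balanced so that, with \<open>\<eta> = s ^ (2 * k)\<close>, every term is of order \<open>s\<close>.\<close>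

definition test_function_constant :: "nat \<Rightarrow> real \<Rightarrow> bool" where
  "test_function_constant k C \<longleftrightarrow> C \<ge> 0 \<and>
     (\<forall>P Q \<eta> s \<phi> a. degree P \<le> k \<longrightarrow> degree Q \<le> k \<longrightarrow> coeff P k = a \<longrightarrow> a \<noteq> 0 \<longrightarrow>
     0 < \<eta> \<longrightarrow> 0 < s \<longrightarrow> s \<le> 1 \<longrightarrow> continuous_on UNIV \<phi> \<longrightarrow> (\<forall>x. \<bar>\<phi> x\<bar> \<le> 1) \<longrightarrow>
     \<bar>gauss_int (\<lambda>x. \<phi> (poly P x) - \<phi> (poly Q x))\<bar>
     \<le> 4 * real k * s + 2 * s / a\<^sup>2 + C / s ^ (2 * k - 1) * (gauss_sq (P - Q) / \<eta> + \<eta> * (1 + gauss_sq P)))"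

lemma test_function_constantD:
  assumes "test_function_constant k C" "degree P \<le> k" "degree Q \<le> k" "coeff P k = a" "a \<noteq> 0"
    "0 < \<eta>" "0 < s" "s \<le> 1" "continuous_on UNIV \<phi>" "\<And>x. \<bar>\<phi> x\<bar> \<le> 1"
  shows "\<bar>gauss_int (\<lambda>x. \<phi> (poly P x) - \<phi> (poly Q x))\<bar>
     \<le> 4 * real k * s + 2 * s / a\<^sup>2 + C / s ^ (2 * k - 1) * (gauss_sq (P - Q) / \<eta> + \<eta> * (1 + gauss_sq P))"
proof -
  note all = assms(1)[unfolded test_function_constant_def, THEN conjunct2, rule_format]
  show ?thesis
    by (rule all[where P = P and Q = Q and \<phi> = \<phi> and a = a]) (fact assms)+
qed

lemma ex_test_function_constant:
  assumes k: "k \<ge> 1"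
  shows "\<exists>C. test_function_constant k C"
proof -
  obtain C where C: "C \<ge> 0" and CC: "\<And>P Q \<eta>. degree P \<le> k \<Longrightarrow> degree Q \<le> k \<Longrightarrow> 0 < \<eta> \<Longrightarrow>
     gauss_int (\<lambda>x. \<bar>poly (pderiv (P - Q)) x\<bar>
            + \<bar>poly (P - Q) x\<bar> * (\<bar>poly (pderiv (pderiv P)) x\<bar> + \<bar>x\<bar>))
     \<le> C * (gauss_sq (P - Q) / \<eta> + \<eta> * (1 + gauss_sq P))"
    using gauss_int_derivative_terms_le[of k] by blast
  show ?thesis
    unfolding test_function_constant_def
  proof (intro exI[of _ C] conjI C allI impI)
    fix P Q :: "real poly" and \<eta> s a :: real and \<phi> :: "real \<Rightarrow> real"
    assume dP: "degree P \<le> k" and dQ: "degree Q \<le> k" and cP: "coeff P k = a" and a: "a \<noteq> 0" and \<eta>: "0 < \<eta>"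
      and s: "0 < s" "s \<le> 1" and \<phi>: "continuous_on UNIV \<phi>" "\<forall>x. \<bar>\<phi> x\<bar> \<le> 1"
    define \<epsilon> where "\<epsilon> = s ^ (2 * k - 1)"
    have e: "0 < \<epsilon>" "\<epsilon> \<le> 1" using s by (auto simp: \<epsilon>_def power_le_one)
    have "degree P = k" using dP cP a le_degree[of P k] by auto
    then have dP': "degree (pderiv P) = k - 1" and lc: "lead_coeff (pderiv P) = k * a"
      using k cP by (auto simp: degree_pderiv coeff_pderiv)
    have "2 * gauss_int (\<lambda>x. \<epsilon> / ((poly (pderiv P) x)\<^sup>2 + \<epsilon>))
        \<le> 2 * (2 * degree (pderiv P) * s + \<epsilon> / (lead_coeff (pderiv P) * s ^ degree (pderiv P))\<^sup>2)"
      using lc a k s e by (intro mult_left_mono gauss_int_small_poly_le) auto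
    also have "\<epsilon> / (lead_coeff (pderiv P) * s ^ degree (pderiv P))\<^sup>2 \<le> s / a\<^sup>2"
    proof -
      \<comment> \<open>The exponent of \<open>\<epsilon>\<close> exceeds that of
        \<open>(s ^ (k - 1))\<^sup>2\<close>, the square of the lower bound on the derivative, by
        exactly one, so one factor \<open>s\<close> is left.\<close>
      have "2 * k - 1 = Suc ((k - 1) * 2)" using k by simp
      then have "\<epsilon> = s * (s ^ (k - 1))\<^sup>2" by (simp add: \<epsilon>_def power_mult)
      then have "\<epsilon> / (lead_coeff (pderiv P) * s ^ degree (pderiv P))\<^sup>2 = s / (k * a)\<^sup>2"
        unfolding lc unfolding dP' using s by (simp add: power_mult_distrib)
      also have "\<dots> \<le> s / a\<^sup>2"
      proof (intro divide_left_mono)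
        have "1 \<le> (real k)\<^sup>2" using k by simp
        then show "a\<^sup>2 \<le> (k * a)\<^sup>2" unfolding power_mult_distrib
          using mult_right_mono[of 1 "(real k)\<^sup>2" "a\<^sup>2"] by simp
      qed (use s a k in auto)
      finally show ?thesis .
    qed
    also have "2 * (2 * degree (pderiv P) * s + s / a\<^sup>2) \<le> 4 * real k * s + 2 * s / a\<^sup>2"
      unfolding dP' using s by (simp add: mult_right_mono)
    finally have 1: "2 * gauss_int (\<lambda>x. \<epsilon> / ((poly (pderiv P) x)\<^sup>2 + \<epsilon>)) \<le> 4 * real k * s + 2 * s / a\<^sup>2" by simp
    have "1 / \<epsilon> * gauss_int (\<lambda>x. \<bar>poly (pderiv (P - Q)) x\<bar>
            + \<bar>poly (P - Q) x\<bar> * (\<bar>poly (pderiv (pderiv P)) x\<bar> + \<bar>x\<bar>))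
       \<le> 1 / \<epsilon> * (C * (gauss_sq (P - Q) / \<eta> + \<eta> * (1 + gauss_sq P)))"
      using e by (intro mult_left_mono CC dP dQ \<eta>) auto
    with 1 gauss_int_test_function_diff_le[OF \<phi>(1) _ e, of P Q] \<phi>(2)
    show "\<bar>gauss_int (\<lambda>x. \<phi> (poly P x) - \<phi> (poly Q x))\<bar>
     \<le> 4 * real k * s + 2 * s / a\<^sup>2 + C / s ^ (2 * k - 1) * (gauss_sq (P - Q) / \<eta> + \<eta> * (1 + gauss_sq P))"
      unfolding \<epsilon>_def[symmetric] by simp
  qed
qed

section \<open>Independence from characteristic functions\<close>

context prob_space
begin

text \<open>Dividing \<open>Z\<close> by a bound makes \<open>1 + Z / L\<close> a probability
  density. The hypothesis says that \<open>V\<close> has the same characteristic function under the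
  tilted measure as under \<open>M\<close>, hence the same law, and the difference of the two
  probabilities of \<open>B\<close> is the claimed integral divided by \<open>L\<close>.\<close>

lemma real_fourier_zero_imp_indicator_zero:
  fixes Z V :: "'a \<Rightarrow> real"
  assumes [measurable]: "Z \<in> borel_measurable M" "V \<in> borel_measurable M" "B \<in> sets borel"
    and K: "\<And>w. w \<in> space M \<Longrightarrow> \<bar>Z w\<bar> \<le> K"
    and zero: "\<And>t. (CLINT w|M. complex_of_real (Z w) * iexp (t * V w)) = 0"
  shows "expectation (\<lambda>w. Z w * indicator B (V w)) = 0"
proof -
  \<comment> \<open>The maximum with 1 keeps the divisor positive when \<open>K\<close> is
    0.\<close>
  define L where "L = max K 1"
  have L: "L > 0" and ZL: "\<bar>Z w\<bar> \<le> L" if "w \<in> space M" for w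
    using K[OF that] by (auto simp: L_def)
  have Lpos: "L > 0" by (simp add: L_def)
  define g where "g w = 1 + Z w / L" for w
  have [measurable]: "g \<in> borel_measurable M" unfolding g_def by measurable
  have g0: "0 \<le> g w" if "w \<in> space M" for w
    using ZL[OF that] Lpos by (simp add: g_def field_simps abs_le_iff)
  have g_AE: "AE w in M. 0 \<le> g w" using g0 by (auto intro: AE_I2)
  have int_Z: "integrable M Z"
    by (rule integrable_const_bound[where B = K]) (auto simp: K intro!: AE_I2)
  have "complex_of_real (expectation Z) = 0" using zero[of 0] by simp
  then have EZ: "expectation Z = 0" by simp
  have int_g: "integrable M g" and Eg: "expectation g = 1"
    unfolding g_def using int_Z EZ prob_space by auto
  define N where "N = density M g"
  have "prob_space N"
  proof
    have "emeasure N (space N) = (\<integral>\<^sup>+w. ennreal (g w) \<partial>M)"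
      by (simp add: N_def emeasure_density cong: nn_integral_cong)
    also have "\<dots> = 1" using int_g Eg g_AE by (subst nn_integral_eq_integral) auto
    finally show "emeasure N (space N) = 1" .
  qed
  then interpret N: prob_space N .
  have [measurable_cong]: "sets N = sets M" by (simp add: N_def)
  have "distr N borel V = distr M borel V"
  proof (rule Levy_uniqueness)
    show "real_distribution (distr N borel V)" "real_distribution (distr M borel V)"
      by (auto intro!: N.real_distribution_distr real_distribution_distr)
    show "char (distr N borel V) = char (distr M borel V)"
    proof
      fix t
      have int1: "integrable M (\<lambda>w. iexp (t * V w))"
        by (rule integrable_const_bound[where B = 1]) auto
      have int2: "integrable M (\<lambda>w. complex_of_real (Z w) * iexp (t * V w))"
        by (rule integrable_const_bound[where B = K]) (auto simp: norm_mult K intro!: AE_I2)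
      have "char (distr N borel V) t = (CLINT w|N. iexp (t * V w))"
        by (simp add: char_def integral_distr)
      also have "\<dots> = (CLINT w|M. g w *\<^sub>R iexp (t * V w))"
        unfolding N_def using g_AE by (subst integral_density) auto
      also have "\<dots> = (CLINT w|M. iexp (t * V w) + of_real (1/L) * (complex_of_real (Z w) * iexp (t * V w)))"
        by (intro Bochner_Integration.integral_cong) (auto simp: g_def scaleR_conv_of_real algebra_simps)
      also have "\<dots> = (CLINT w|M. iexp (t * V w))"
        using int1 int2 zero[of t] by (subst Bochner_Integration.integral_add) auto
      also have "\<dots> = char (distr M borel V) t" by (simp add: char_def integral_distr)
      finally show "char (distr N borel V) t = char (distr M borel V) t" .
    qed
  qed
  then have "measure (distr N borel V) B = measure (distr M borel V) B" by simp
  then have "N.expectation (\<lambda>w. indicat_real B (V w)) = expectation (\<lambda>w. indicat_real B (V w))"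
    using integral_distr[of V N borel "indicat_real B"] integral_distr[of V M borel "indicat_real B"]
    by simp
  moreover have "N.expectation (\<lambda>w. indicat_real B (V w)) = expectation (\<lambda>w. g w * indicator B (V w))"
    unfolding N_def using g_AE by (subst integral_density) auto
  moreover have "expectation (\<lambda>w. g w * indicator B (V w))
      = expectation (\<lambda>w. indicat_real B (V w) + 1/L * (Z w * indicator B (V w)))"
    by (intro Bochner_Integration.integral_cong) (auto simp: g_def algebra_simps)
  moreover have "\<dots> = expectation (\<lambda>w. indicat_real B (V w)) + 1/L * expectation (\<lambda>w. Z w * indicator B (V w))"
  proof (subst Bochner_Integration.integral_add)
    show "integrable M (\<lambda>w. indicat_real B (V w))"
      by (rule integrable_const_bound[where B = 1]) auto
    have "integrable M (\<lambda>w. Z w * indicator B (V w))"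
      by (rule integrable_const_bound[where B = L])
         (auto simp: ZL Lpos less_imp_le intro!: AE_I2 split: split_indicator)
    then show "integrable M (\<lambda>w. 1/L * (Z w * indicator B (V w)))"
      by (rule integrable_mult_right)
  qed simp
  ultimately show ?thesis using Lpos by simp
qed

text \<open>Real and imaginary parts inherit the hypothesis, since the transform of
  \<open>cnj Z\<close> at \<open>t\<close> is the conjugate of that of \<open>Z\<close> at
  \<open>-t\<close>. Complex \<open>Z\<close> is what the induction over several coordinates
  needs.\<close>

lemma fourier_zero_imp_indicator_zero:
  fixes Z :: "'a \<Rightarrow> complex" and V :: "'a \<Rightarrow> real"
  assumes Zm [measurable]: "Z \<in> borel_measurable M" and Vm [measurable]: "V \<in> borel_measurable M" and B: "B \<in> sets borel"
    and K: "\<And>w. w \<in> space M \<Longrightarrow> cmod (Z w) \<le> K"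
    and zero: "\<And>t. (CLINT w|M. Z w * iexp (t * V w)) = 0"
  shows "(CLINT w|M. Z w * indicator B (V w)) = 0"
proof -
  have [measurable]: "(\<lambda>w. cnj (Z w)) \<in> borel_measurable M"
    by (rule measurable_compose[OF Zm]) (intro borel_measurable_continuous_onI continuous_intros)
  have int: "integrable M (\<lambda>w. Z w * iexp (t * V w))" "integrable M (\<lambda>w. cnj (Z w) * iexp (t * V w))" for t
    by (rule integrable_const_bound[where B = K]; auto simp: norm_mult K intro!: AE_I2)+
  have zero': "(CLINT w|M. cnj (Z w) * iexp (t * V w)) = 0" for t
  proof -
    have "(CLINT w|M. cnj (Z w) * iexp (t * V w)) = (CLINT w|M. cnj (Z w * iexp ((-t) * V w)))"
      by (intro Bochner_Integration.integral_cong) (auto simp: exp_cnj)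
    also have "\<dots> = cnj (CLINT w|M. Z w * iexp ((-t) * V w))" by (rule Bochner_Integration.integral_cnj)
    finally show ?thesis using zero[of "-t"] by simp
  qed
  have Re: "complex_of_real (Re z) = (z + cnj z) / 2" and Im: "complex_of_real (Im z) = (z - cnj z) / (2 * \<i>)" for z
    by (auto simp: complex_eq_iff)
  have "(CLINT w|M. complex_of_real (Re (Z w)) * iexp (t * V w))
      = (CLINT w|M. 1/2 * (Z w * iexp (t * V w) + cnj (Z w) * iexp (t * V w)))" for t
    unfolding Re by (simp add: algebra_simps add_divide_distrib)
  then have "(CLINT w|M. complex_of_real (Re (Z w)) * iexp (t * V w)) = 0" for t
    using int[of t] zero[of t] zero'[of t]
    by (simp only: integral_mult_right_zero Bochner_Integration.integral_add) simp
  then have 1: "expectation (\<lambda>w. Re (Z w) * indicator B (V w)) = 0"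
    by (intro real_fourier_zero_imp_indicator_zero[where K = K])
       (auto simp: B intro: order_trans[OF abs_Re_le_cmod K])
  have "(CLINT w|M. complex_of_real (Im (Z w)) * iexp (t * V w))
      = (CLINT w|M. 1/(2*\<i>) * (Z w * iexp (t * V w) - cnj (Z w) * iexp (t * V w)))" for t
    unfolding Im by (simp add: algebra_simps diff_divide_distrib)
  then have "(CLINT w|M. complex_of_real (Im (Z w)) * iexp (t * V w)) = 0" for t
    using int[of t] zero[of t] zero'[of t]
    by (simp only: integral_mult_right_zero Bochner_Integration.integral_diff) simp
  then have 2: "expectation (\<lambda>w. Im (Z w) * indicator B (V w)) = 0"
    by (intro real_fourier_zero_imp_indicator_zero[where K = K])
       (auto simp: B intro: order_trans[OF abs_Im_le_cmod K])
  obtain w0 where "w0 \<in> space M" using not_empty by blast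
  then have K0: "0 \<le> K" by (rule order_trans[OF norm_ge_zero K])
  have intB: "integrable M (\<lambda>w. Z w * indicator B (V w))"
    using B by (intro integrable_const_bound[where B = K])
      (auto simp: norm_mult K K0 intro!: AE_I2 split: split_indicator)
  have "(\<lambda>w. Re (Z w * indicator B (V w))) = (\<lambda>w. Re (Z w) * indicator B (V w))"
    "(\<lambda>w. Im (Z w * indicator B (V w))) = (\<lambda>w. Im (Z w) * indicator B (V w))"
    by (auto split: split_indicator)
  then have "Re (CLINT w|M. Z w * indicator B (V w)) = 0" "Im (CLINT w|M. Z w * indicator B (V w)) = 0"
    using 1 2 integral_Re[OF intB] integral_Im[OF intB] by simp_all
  then show ?thesis by (simp add: complex_eq_iff)
qed

text \<open>One coordinate at a time is turned from an exponential into an indicator. While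
  coordinate \<open>j\<close> is treated, the exponentials of the others are absorbed into
  \<open>Z\<close>; afterwards the indicator is absorbed instead.\<close>

lemma multivariate_fourier_zero_imp_indicator_zero:
  fixes Z :: "'a \<Rightarrow> complex" and V :: "'i \<Rightarrow> 'a \<Rightarrow> real"
  assumes "finite I" and [measurable]: "\<And>i. i \<in> I \<Longrightarrow> V i \<in> borel_measurable M"
    and Bm [measurable]: "\<And>i. i \<in> I \<Longrightarrow> B i \<in> sets borel"
    and "Z \<in> borel_measurable M" and "\<And>w. w \<in> space M \<Longrightarrow> cmod (Z w) \<le> K"
    and "\<And>t. (CLINT w|M. Z w * iexp (\<Sum>i\<in>I. t i * V i w)) = 0"
  shows "(CLINT w|M. Z w * (\<Prod>i\<in>I. indicator (B i) (V i w))) = 0"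
  using assms
proof (induction I arbitrary: Z rule: finite_induct)
  case empty
  then show ?case by simp
next
  case (insert j I)
  note [measurable] = insert.prems(1,2,3)
  have Vj [measurable]: "V j \<in> borel_measurable M" and Bj [measurable]: "B j \<in> sets borel" using insert.prems by auto
  let ?Z = "\<lambda>w. Z w * indicator (B j) (V j w)"
  have "(CLINT w|M. ?Z w * (\<Prod>i\<in>I. indicator (B i) (V i w))) = 0"
  proof (rule insert.IH)
    show "?Z \<in> borel_measurable M" by measurable
    show "cmod (?Z w) \<le> K" if "w \<in> space M" for w
      using insert.prems(4)[OF that] by (auto split: split_indicator intro: order_trans[OF norm_ge_zero])
    fix t :: "'i \<Rightarrow> real"
    have "(CLINT w|M. (Z w * iexp (\<Sum>i\<in>I. t i * V i w)) * indicator (B j) (V j w)) = 0"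
    proof (rule fourier_zero_imp_indicator_zero[where K = K])
      have "(\<lambda>w. \<Sum>i\<in>I. t i * V i w) \<in> borel_measurable M"
        using insert.prems(1) by (intro borel_measurable_sum borel_measurable_times) auto
      then show "(\<lambda>w. Z w * iexp (\<Sum>i\<in>I. t i * V i w)) \<in> borel_measurable M" by measurable
      show "cmod (Z w * iexp (\<Sum>i\<in>I. t i * V i w)) \<le> K" if "w \<in> space M" for w
        using insert.prems(4)[OF that] by (simp add: norm_mult)
      fix s
      have "(\<Sum>i\<in>insert j I. (t(j := s)) i * V i w) = s * V j w + (\<Sum>i\<in>I. t i * V i w)" for w
      proof -
        have "(\<Sum>i\<in>I. (t(j := s)) i * V i w) = (\<Sum>i\<in>I. t i * V i w)"
          using insert.hyps by (intro sum.cong) auto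
        then show ?thesis using insert.hyps by simp
      qed
      then show "(CLINT w|M. Z w * iexp (\<Sum>i\<in>I. t i * V i w) * iexp (s * V j w)) = 0"
        using insert.prems(5)[of "t(j := s)"] by (simp add: exp_add distrib_left mult_ac)
    qed fact+
    then show "(CLINT w|M. ?Z w * iexp (\<Sum>i\<in>I. t i * V i w)) = 0" by (simp add: mult_ac)
  qed (use insert.prems in auto)
  then show ?case using insert.hyps by (simp add: mult_ac)
qed

text \<open>Exponentials become indicators in two stages: first in \<open>U\<close>, with the
  centred factor \<open>iexp (\<Sum>i\<in>I. t i * V i w) - c\<close>, then in the
  \<open>V i\<close>, with the centred factor \<open>indicator A (U w) - p\<close>. This gives
  independence on boxes, and uniqueness of finite measures extends it.\<close>

lemma joint_distr_if_char_factorizes: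
  fixes U :: "'a \<Rightarrow> real" and V :: "'i \<Rightarrow> 'a \<Rightarrow> real"
  assumes I: "finite I" and Um [measurable]: "U \<in> borel_measurable M"
    and Vm [measurable]: "\<And>i. i \<in> I \<Longrightarrow> V i \<in> borel_measurable M"
    and factor: "\<And>u t. (CLINT w|M. iexp (u * U w) * iexp (\<Sum>i\<in>I. t i * V i w))
        = (CLINT w|M. iexp (u * U w)) * (CLINT w|M. iexp (\<Sum>i\<in>I. t i * V i w))"
  shows "distr M borel U \<Otimes>\<^sub>M distr M (PiM I (\<lambda>_. borel)) (\<lambda>w. \<lambda>i\<in>I. V i w)
    = distr M (borel \<Otimes>\<^sub>M PiM I (\<lambda>_. borel)) (\<lambda>w. (U w, \<lambda>i\<in>I. V i w))"
proof -
  define Y where "Y = (\<lambda>w. \<lambda>i\<in>I. V i w)"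
  have Ym [measurable]: "Y \<in> measurable M (PiM I (\<lambda>_. borel))"
    unfolding Y_def by (intro measurable_restrict) auto
  have sumV [measurable]: "(\<lambda>w. \<Sum>i\<in>I. t i * V i w) \<in> borel_measurable M" for t
    by (intro borel_measurable_sum borel_measurable_times) auto
  have rect: "emeasure M ((U -` A \<inter> space M) \<inter> (Y -` Pi\<^sub>E I B \<inter> space M))
      = emeasure M (U -` A \<inter> space M) * emeasure M (Y -` Pi\<^sub>E I B \<inter> space M)"
    if A [measurable]: "A \<in> sets borel" and B: "\<And>i. i \<in> I \<Longrightarrow> B i \<in> sets borel" for A B
  proof -
    define p where "p = prob (U -` A \<inter> space M)"
    let ?S = "Y -` Pi\<^sub>E I B \<inter> space M"
    have S [measurable]: "?S \<in> sets M" using B I by (intro measurable_sets[OF Ym] sets_PiM_I_finite) auto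
    have p: "p \<le> 1" "p \<ge> 0" by (auto simp: p_def)
    have prodS: "(\<Prod>i\<in>I. indicator (B i) (V i w)) = (indicator ?S w :: complex)" if "w \<in> space M" for w
    proof (cases "\<forall>i\<in>I. V i w \<in> B i")
      case True
      then have "w \<in> ?S" using that by (auto simp: Y_def)
      then show ?thesis using True by simp
    next
      case False
      then obtain i where i: "i \<in> I" "V i w \<notin> B i" by auto
      then have "w \<notin> ?S" by (auto simp: Y_def PiE_iff)
      moreover have "(\<Prod>i\<in>I. indicator (B i) (V i w)) = (0::complex)"
        using I i by (intro prod_zero) (auto intro!: bexI[of _ i])
      ultimately show ?thesis by simp
    qed
    have zero: "(CLINT w|M. (indicator A (U w) - complex_of_real p) * iexp (\<Sum>i\<in>I. t i * V i w)) = 0" for t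
    proof -
      define c where "c = (CLINT w|M. iexp (\<Sum>i\<in>I. t i * V i w))"
      have int: "integrable M (\<lambda>w. iexp (\<Sum>i\<in>I. t i * V i w))"
        by (rule integrable_const_bound[where B = 1]) auto
      have intA: "integrable M (\<lambda>w. indicator A (U w) * iexp (\<Sum>i\<in>I. t i * V i w))"
        by (rule integrable_const_bound[where B = 1]) (auto simp: norm_mult split: split_indicator)
      have intI: "integrable M (\<lambda>w. indicator A (U w) :: complex)"
        by (rule integrable_const_bound[where B = 1]) (auto split: split_indicator)
      have "(CLINT w|M. (iexp (\<Sum>i\<in>I. t i * V i w) - c) * indicator A (U w)) = 0"
      proof (rule fourier_zero_imp_indicator_zero[where K = "1 + cmod c"])
        show "cmod (iexp (\<Sum>i\<in>I. t i * V i w) - c) \<le> 1 + cmod c" for w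
          by (rule order_trans[OF norm_triangle_ineq4]) simp
        fix u
        have int1: "integrable M (\<lambda>w. iexp (u * U w))"
          by (rule integrable_const_bound[where B = 1]) auto
        have int2: "integrable M (\<lambda>w. iexp (u * U w) * iexp (\<Sum>i\<in>I. t i * V i w))"
          by (rule integrable_const_bound[where B = 1]) (auto simp: norm_mult)
        have "(CLINT w|M. (iexp (\<Sum>i\<in>I. t i * V i w) - c) * iexp (u * U w))
            = (CLINT w|M. iexp (u * U w) * iexp (\<Sum>i\<in>I. t i * V i w) - iexp (u * U w) * c)"
          by (simp add: algebra_simps)
        also have "\<dots> = 0"
          using int1 int2 factor[of u t] by (subst Bochner_Integration.integral_diff) (auto simp: c_def)
        finally show "(CLINT w|M. (iexp (\<Sum>i\<in>I. t i * V i w) - c) * iexp (u * U w)) = 0" .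
      qed auto
      moreover have "(CLINT w|M. (iexp (\<Sum>i\<in>I. t i * V i w) - c) * indicator A (U w))
          = (CLINT w|M. indicator A (U w) * iexp (\<Sum>i\<in>I. t i * V i w) - c * indicator A (U w))"
        by (simp add: algebra_simps)
      moreover have "\<dots> = (CLINT w|M. indicator A (U w) * iexp (\<Sum>i\<in>I. t i * V i w)) - c * (CLINT w|M. indicator A (U w))"
        using intA intI by (subst Bochner_Integration.integral_diff) auto
      moreover have "(CLINT w|M. indicator A (U w)) = complex_of_real p"
      proof -
        have "(CLINT w|M. indicator A (U w)) = (CLINT w|M. complex_of_real (indicator (U -` A \<inter> space M) w))"
          by (intro Bochner_Integration.integral_cong) (auto split: split_indicator)
        then show ?thesis by (simp add: p_def)
      qed
      ultimately have "(CLINT w|M. indicator A (U w) * iexp (\<Sum>i\<in>I. t i * V i w)) = c * complex_of_real p" by simp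
      moreover have "(CLINT w|M. (indicator A (U w) - complex_of_real p) * iexp (\<Sum>i\<in>I. t i * V i w))
          = (CLINT w|M. indicator A (U w) * iexp (\<Sum>i\<in>I. t i * V i w) - complex_of_real p * iexp (\<Sum>i\<in>I. t i * V i w))"
        by (simp add: algebra_simps)
      moreover have "\<dots> = (CLINT w|M. indicator A (U w) * iexp (\<Sum>i\<in>I. t i * V i w)) - complex_of_real p * c"
        unfolding c_def using intA int by (subst Bochner_Integration.integral_diff) auto
      ultimately show ?thesis by simp
    qed
    have "(CLINT w|M. (indicator A (U w) - complex_of_real p) * (\<Prod>i\<in>I. indicator (B i) (V i w))) = 0"
    proof (rule multivariate_fourier_zero_imp_indicator_zero[where K = 2])
      show "cmod (indicator A (U w) - complex_of_real p) \<le> 2" for w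
        using p by (intro order_trans[OF norm_triangle_ineq4]) (auto split: split_indicator)
    qed (use I B zero in auto)
    also have "(CLINT w|M. (indicator A (U w) - complex_of_real p) * (\<Prod>i\<in>I. indicator (B i) (V i w)))
        = (CLINT w|M. complex_of_real (indicator ((U -` A \<inter> space M) \<inter> ?S) w - p * indicator ?S w))"
      by (intro Bochner_Integration.integral_cong) (auto simp: prodS split: split_indicator)
    finally have "expectation (\<lambda>w. indicator ((U -` A \<inter> space M) \<inter> ?S) w - p * indicator ?S w) = 0"
      by (simp only: integral_complex_of_real of_real_eq_0_iff)
    then have "prob ((U -` A \<inter> space M) \<inter> ?S) = p * prob ?S"
      by (subst (asm) Bochner_Integration.integral_diff) (auto simp: emeasure_eq_measure)
    then show ?thesis
      unfolding p_def by (simp add: emeasure_eq_measure ennreal_mult[symmetric])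
  qed
  have dens: "emeasure M ((U -` A \<inter> space M) \<inter> (Y -` B \<inter> space M))
      = emeasure M (U -` A \<inter> space M) * emeasure M (Y -` B \<inter> space M)"
    if A [measurable]: "A \<in> sets borel" and B: "B \<in> sets (PiM I (\<lambda>_. borel))" for A B
  proof -
    let ?A = "U -` A \<inter> space M"
    \<comment> \<open>For fixed \<open>A\<close>, both sides are finite measures in \<open>B\<close>
      that agree on boxes by \<open>rect\<close>.\<close>
    let ?P = "distr (density M (indicator ?A)) (PiM I (\<lambda>_. borel)) Y"
    let ?Q = "scale_measure (emeasure M ?A) (distr M (PiM I (\<lambda>_. borel)) Y)"
    have P: "emeasure ?P B = emeasure M (?A \<inter> (Y -` B \<inter> space M))" if "B \<in> sets (PiM I (\<lambda>_. borel))" for B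
      using that by (simp add: emeasure_distr emeasure_density indicator_inter_arith[symmetric])
    have Q: "emeasure ?Q B = emeasure M ?A * emeasure M (Y -` B \<inter> space M)" if "B \<in> sets (PiM I (\<lambda>_. borel))" for B
      using that by (simp add: emeasure_distr)
    have "?P = ?Q"
    proof (rule measure_eqI_PiM_finite[OF I, where A = "\<lambda>_. space (PiM I (\<lambda>_. borel))"])
      show "emeasure ?P (Pi\<^sub>E I B) = emeasure ?Q (Pi\<^sub>E I B)" if "\<And>i. i \<in> I \<Longrightarrow> B i \<in> sets borel" for B
        using that I by (simp only: P Q sets_PiM_I_finite rect A)
      show "range (\<lambda>_::nat. space (PiM I (\<lambda>_. borel))) \<subseteq> prod_algebra I (\<lambda>_. borel :: real measure)"
        using I by (auto simp: space_PiM intro!: prod_algebraI_finite)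
      show "emeasure ?P (space (PiM I (\<lambda>_. borel))) \<noteq> \<infinity>"
        by (subst P) (auto simp: emeasure_eq_measure)
    qed auto
    then show ?thesis using P[OF B] Q[OF B] by simp
  qed
  have "distr M borel U \<Otimes>\<^sub>M distr M (PiM I (\<lambda>_. borel)) Y
    = distr M (borel \<Otimes>\<^sub>M PiM I (\<lambda>_. borel)) (\<lambda>w. (U w, Y w))"
  proof (rule pair_measure_eqI)
    show "sigma_finite_measure (distr M borel U)" "sigma_finite_measure (distr M (PiM I (\<lambda>_. borel)) Y)"
      by (auto intro!: prob_space_imp_sigma_finite prob_space_distr)
    fix A B assume "A \<in> sets (distr M borel U)" "B \<in> sets (distr M (PiM I (\<lambda>_. borel)) Y)"
    then have A: "A \<in> sets borel" and B: "B \<in> sets (PiM I (\<lambda>_. borel))" by auto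
    have "(\<lambda>w. (U w, Y w)) -` (A \<times> B) \<inter> space M = (U -` A \<inter> space M) \<inter> (Y -` B \<inter> space M)" by auto
    then show "emeasure (distr M borel U) A * emeasure (distr M (PiM I (\<lambda>_. borel)) Y) B
        = emeasure (distr M (borel \<Otimes>\<^sub>M PiM I (\<lambda>_. borel)) (\<lambda>w. (U w, Y w))) (A \<times> B)"
      using A B dens[OF A B] by (simp add: emeasure_distr)
  qed auto
  then show ?thesis by (simp only: Y_def)
qed

end

section \<open>Conditioning a Hermite sum on the directions orthogonal to a unit vector\<close>

text \<open>The same recursion as in \<open>hermite_like_poly_exists\<close>. Unlike the iterated
  derivative in \<open>hermite\<close>, it gives access to degrees and coefficients.\<close>

fun hermite_poly :: "nat \<Rightarrow> real poly" where
  "hermite_poly 0 = 1"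
| "hermite_poly (Suc k) = [:0, 1:] * hermite_poly k - pderiv (hermite_poly k)"

lemma hermite_eq_poly: "hermite k = poly (hermite_poly k)"
proof -
  have "(deriv ^^ k) (\<lambda>y. exp (- (y\<^sup>2 / 2))) = (\<lambda>x. (-1) ^ k * poly (hermite_poly k) x * exp (- (x\<^sup>2 / 2)))"
  proof (induction k)
    case (Suc k)
    have "((\<lambda>x. (-1) ^ k * poly (hermite_poly k) x * exp (- (x\<^sup>2 / 2))) has_real_derivative
        (-1) ^ Suc k * poly (hermite_poly (Suc k)) x * exp (- (x\<^sup>2 / 2))) (at x)" for x
      by (auto intro!: derivative_eq_intros poly_DERIV simp: algebra_simps)
    then have "deriv (\<lambda>x. (-1) ^ k * poly (hermite_poly k) x * exp (- (x\<^sup>2 / 2)))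
        = (\<lambda>x. (-1) ^ Suc k * poly (hermite_poly (Suc k)) x * exp (- (x\<^sup>2 / 2)))"
      by (intro ext DERIV_imp_deriv)
    then show ?case by (simp only: funpow.simps(2) o_apply Suc.IH)
  qed simp
  then show ?thesis
    by (intro ext) (simp add: hermite_def exp_minus field_simps flip: power_mult_distrib)
qed

lemma borel_measurable_hermite [measurable]: "hermite k \<in> borel_measurable borel"
  unfolding hermite_eq_poly by measurable

lemma degree_hermite_poly: "degree (hermite_poly k) \<le> k"
  and coeff_hermite_poly: "coeff (hermite_poly k) k = 1"
proof (induction k)
  case (Suc k)
  {
    case 1
    have "degree ([:0, 1:] * hermite_poly k) \<le> Suc k"
      using Suc degree_pCons_le[of 0 "hermite_poly k"] by simp
    moreover have "degree (pderiv (hermite_poly k)) \<le> Suc k"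
      using Suc by (simp add: degree_pderiv)
    ultimately show ?case by (simp only: hermite_poly.simps degree_diff_le)
  next
    case 2
    show ?case using Suc by (simp add: coeff_pderiv coeff_eq_0)
  }
qed auto

text \<open>The shift \<open>y\<close> has no influence on the coefficient of degree
  \<open>n\<close>. This is why conditioning on the orthogonal remainders leaves a deterministic
  leading coefficient.\<close>

lemma coeff_pcompose_linear:
  fixes p :: "real poly"
  assumes "degree p \<le> n"
  shows "coeff (pcompose p [:y, c:]) n = coeff p n * c ^ n"
  using assms
proof (induction p arbitrary: n)
  case (pCons a p)
  show ?case
  proof (cases n)
    case 0
    then have "p = 0" using pCons by (auto split: if_splits)
    then show ?thesis using 0 by simp
  next
    case (Suc m)
    then have p: "degree p \<le> m" using pCons by (cases "p = 0") auto
    have "degree (pcompose p [:y, c:]) \<le> degree p * degree [:y, c:]" by (rule degree_pcompose_le)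
    also have "\<dots> \<le> m * 1" using p by (intro mult_mono) auto
    finally have "coeff (pcompose p [:y, c:]) (Suc m) = 0" by (intro coeff_eq_0) simp
    then show ?thesis using pCons.IH[OF p] Suc by (simp add: pcompose_pCons)
  qed
qed simp

section \<open>Linearity, laws and orthogonal splitting of the isonormal process\<close>

context isonormal_process
begin

lemma centered_gaussian_X: "centered_gaussian M (X h)"
  using gaussian_family[of "{h}" "\<lambda>_. 1"] by simp

lemma measurable_X [measurable]: "X h \<in> borel_measurable M"
  using centered_gaussian_X by (simp add: centered_gaussian_def)

lemma integrable_X_square: "integrable M (\<lambda>w. (X h w)\<^sup>2)"
proof -
  consider s where "s > 0" "distributed M lborel (X h) (normal_density 0 s)" | "AE w in M. X h w = 0"
    using centered_gaussian_X[of h] by (auto simp: centered_gaussian_def)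
  then show ?thesis
  proof cases
    case 1
    then show ?thesis
      using integrable_normal_moment[of s 0 2]
      by (subst distributed_integrable[OF 1(2), symmetric]) auto
  next
    case 2
    then have "AE w in M. (X h w)\<^sup>2 = 0" by eventually_elim simp
    then have "integrable M (\<lambda>w. (X h w)\<^sup>2) = integrable M (\<lambda>w. 0 :: real)"
      by (intro integrable_cong_AE) simp_all
    then show ?thesis by simp
  qed
qed

lemma integrable_X_mult: "integrable M (\<lambda>w. X g w * X h w)"
proof (rule Bochner_Integration.integrable_bound)
  show "integrable M (\<lambda>w. (X g w)\<^sup>2 + (X h w)\<^sup>2)"
    by (intro Bochner_Integration.integrable_add integrable_X_square)
  show "AE w in M. norm (X g w * X h w) \<le> norm ((X g w)\<^sup>2 + (X h w)\<^sup>2)"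
    using abs_mult_le_sum_squares by (intro AE_I2) (simp add: abs_mult)
qed simp

text \<open>The covariance alone forces linearity: the second moment of the defect expands into
  inner products that cancel.\<close>

lemma X_linear: "AE w in M. X (a *\<^sub>R x + b *\<^sub>R y) w = a * X x w + b * X y w"
proof -
  define z where "z = a *\<^sub>R x + b *\<^sub>R y"
  let ?D = "\<lambda>w. (X z w - (a * X x w + b * X y w))\<^sup>2"
  have eq: "?D = (\<lambda>w. X z w * X z w + (- 2 * a) * (X z w * X x w) + (- 2 * b) * (X z w * X y w)
      + a\<^sup>2 * (X x w * X x w) + (2 * a * b) * (X x w * X y w) + b\<^sup>2 * (X y w * X y w))"
    by (simp add: fun_eq_iff power2_eq_square algebra_simps)
  have int: "integrable M ?D" unfolding eq
    by (intro Bochner_Integration.integrable_add integrable_mult_right integrable_X_mult)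
  have "expectation ?D = z \<bullet> z + (- 2 * a) * (z \<bullet> x) + (- 2 * b) * (z \<bullet> y)
      + a\<^sup>2 * (x \<bullet> x) + (2 * a * b) * (x \<bullet> y) + b\<^sup>2 * (y \<bullet> y)"
    unfolding eq
    by (simp only: Bochner_Integration.integral_add integral_mult_right_zero covariance
        Bochner_Integration.integrable_add integrable_mult_right integrable_X_mult)
  also have "\<dots> = 0"
    by (simp add: z_def inner_add_left inner_add_right inner_commute algebra_simps power2_eq_square)
  finally have "AE w in M. ?D w = 0"
    using int by (subst (asm) integral_nonneg_eq_0_iff_AE) auto
  then show ?thesis unfolding z_def by eventually_elim simp
qed

lemma X_sum:
  assumes "finite S"
  shows "AE w in M. X (\<Sum>i\<in>S. a i *\<^sub>R x i) w = (\<Sum>i\<in>S. a i * X (x i) w)"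
  using assms
proof (induction S rule: finite_induct)
  case empty
  show ?case using X_linear[of 0 0 0 0] by simp
next
  case (insert j S)
  show ?case using insert.IH X_linear[of "a j" "x j" 1 "\<Sum>i\<in>S. a i *\<^sub>R x i"]
    by eventually_elim (use insert.hyps in simp)
qed

text \<open>The covariance identifies the variance with \<open>(norm h)\<^sup>2\<close>. In the
  degenerate alternative it forces \<open>h = 0\<close>, where both sides are 1.\<close>

lemma char_X: "(CLINT w|M. iexp (X h w)) = exp (- (norm h)\<^sup>2 / 2)"
proof -
  have var: "expectation (\<lambda>w. (X h w)\<^sup>2) = (norm h)\<^sup>2"
    using covariance[of h h] by (simp add: power2_eq_square dot_square_norm)
  consider s where "s > 0" "distributed M lborel (X h) (normal_density 0 s)" | "AE w in M. X h w = 0"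
    using centered_gaussian_X[of h] by (auto simp: centered_gaussian_def)
  then show ?thesis
  proof cases
    case 1
    have "variance (X h) = s\<^sup>2" by (rule normal_distributed_variance[OF 1])
    moreover have "expectation (X h) = 0" by (rule normal_distributed_expectation[OF 1])
    ultimately have s: "s\<^sup>2 = (norm h)\<^sup>2" using var by simp
    have D: "distributed M lborel (\<lambda>w. X h w / s) std_normal_density"
      using normal_standard_normal_convert[of s "X h" 0] 1 by simp
    have "(CLINT w|M. iexp (X h w)) = (CLINT w|M. iexp (s * (X h w / s)))" using 1 by simp
    also have "\<dots> = (CLINT x|distr M lborel (\<lambda>w. X h w / s). iexp (s * x))"
      by (subst integral_distr) auto
    also have "\<dots> = char std_normal_distribution s"
      unfolding char_def distributed_distr_eq_density[OF D] ..
    also have "\<dots> = exp (- s\<^sup>2 / 2)" by (simp add: char_std_normal_distribution)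
    finally show ?thesis by (simp add: s)
  next
    case 2
    then have "expectation (\<lambda>w. (X h w)\<^sup>2) = expectation (\<lambda>_. 0)" by (intro integral_cong_AE) auto
    then have "norm h = 0" using var by simp
    moreover have "(CLINT w|M. iexp (X h w)) = (CLINT w|M. 1)" using 2 by (intro integral_cong_AE) auto
    ultimately show ?thesis using prob_space by simp
  qed
qed

lemma distr_X:
  assumes "norm h = 1"
  shows "distr M borel (X h) = std_normal_distribution"
proof (rule Levy_uniqueness)
  show "real_distribution (distr M borel (X h))" by (rule real_distribution_distr) simp
  show "real_distribution std_normal_distribution" by (rule real_dist_normal_dist)
  show "char (distr M borel (X h)) = char std_normal_distribution"
  proof
    fix t
    have "char (distr M borel (X h)) t = (CLINT w|M. iexp (t * X h w))"
      by (simp add: char_def integral_distr)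
    also have "\<dots> = (CLINT w|M. iexp (X (t *\<^sub>R h) w))"
      using X_linear[of t h 0 0] by (intro integral_cong_AE) auto
    also have "\<dots> = char std_normal_distribution t"
      using assms by (simp add: char_X char_std_normal_distribution)
    finally show "char (distr M borel (X h)) t = char std_normal_distribution t" .
  qed
qed

text \<open>A linear combination of the \<open>X (v i)\<close> is almost surely \<open>X z\<close>
  with \<open>z\<close> orthogonal to \<open>h\<close>. By Pythagoras the exponent in
  \<open>char_X\<close> splits, so the characteristic function factorizes.\<close>

lemma joint_distr_orthogonal:
  assumes S: "finite S" and h: "norm h = 1" and orth: "\<And>i. i \<in> S \<Longrightarrow> h \<bullet> v i = 0"
  shows "distr M (borel \<Otimes>\<^sub>M PiM S (\<lambda>_. borel)) (\<lambda>w. (X h w, \<lambda>i\<in>S. X (v i) w))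
    = std_normal_distribution \<Otimes>\<^sub>M distr M (PiM S (\<lambda>_. borel)) (\<lambda>w. \<lambda>i\<in>S. X (v i) w)"
proof -
  have "(CLINT w|M. iexp (u * X h w) * iexp (\<Sum>i\<in>S. t i * X (v i) w))
      = (CLINT w|M. iexp (u * X h w)) * (CLINT w|M. iexp (\<Sum>i\<in>S. t i * X (v i) w))" for u t
  proof -
    define z where "z = (\<Sum>i\<in>S. t i *\<^sub>R v i)"
    have z: "AE w in M. X z w = (\<Sum>i\<in>S. t i * X (v i) w)" unfolding z_def by (rule X_sum[OF S])
    have hz: "h \<bullet> z = 0" by (simp add: z_def inner_sum_right orth)
    have "(CLINT w|M. iexp (u * X h w) * iexp (\<Sum>i\<in>S. t i * X (v i) w))
        = (CLINT w|M. iexp (X (u *\<^sub>R h + 1 *\<^sub>R z) w))"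
      using z X_linear[of u h 1 z] by (intro integral_cong_AE) (auto simp: exp_add distrib_left)
    also have "\<dots> = exp (- (norm (u *\<^sub>R h + z))\<^sup>2 / 2)" by (simp add: char_X)
    also have "(norm (u *\<^sub>R h + z))\<^sup>2 = (norm (u *\<^sub>R h))\<^sup>2 + (norm z)\<^sup>2"
      using hz by (simp add: norm_add_Pythagorean orthogonal_def)
    also have "complex_of_real (exp (- ((norm (u *\<^sub>R h))\<^sup>2 + (norm z)\<^sup>2) / 2))
        = (CLINT w|M. iexp (X (u *\<^sub>R h) w)) * (CLINT w|M. iexp (X z w))"
      unfolding char_X of_real_mult[symmetric] exp_add[symmetric] by (simp only: add_divide_distrib minus_add_distrib minus_divide_left)
    also have "(CLINT w|M. iexp (X (u *\<^sub>R h) w)) = (CLINT w|M. iexp (u * X h w))"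
      using X_linear[of u h 0 0] by (intro integral_cong_AE) auto
    also have "(CLINT w|M. iexp (X z w)) = (CLINT w|M. iexp (\<Sum>i\<in>S. t i * X (v i) w))"
      using z by (intro integral_cong_AE) auto
    finally show ?thesis .
  qed
  then show ?thesis
    using joint_distr_if_char_factorizes[of S "X h" "\<lambda>i. X (v i)"] S distr_X[OF h] by simp
qed

section \<open>Finite Hermite sums\<close>

lemma integrable_hermite_mult:
  assumes "norm g = 1" "norm h = 1"
  shows "integrable M (\<lambda>w. hermite k (X g w) * hermite k (X h w))"
proof -
  have sq: "integrable M (\<lambda>w. (hermite k (X g w))\<^sup>2)" if "norm g = 1" for g
    unfolding hermite_eq_poly
    by (rule integrable_distr[OF measurable_X]) (simp add: distr_X[OF that] integrable_std_normal_poly_square)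
  show ?thesis
  proof (rule Bochner_Integration.integrable_bound)
    show "integrable M (\<lambda>w. (hermite k (X g w))\<^sup>2 + (hermite k (X h w))\<^sup>2)"
      using assms by (intro Bochner_Integration.integrable_add sq)
    show "AE w in M. norm (hermite k (X g w) * hermite k (X h w)) \<le> norm ((hermite k (X g w))\<^sup>2 + (hermite k (X h w))\<^sup>2)"
      using abs_mult_le_sum_squares by (intro AE_I2) (simp add: abs_mult)
  qed simp
qed

lemma integrable_hermite_sum_square:
  assumes "\<And>g. g \<in> S \<Longrightarrow> norm g = 1"
  shows "integrable M (\<lambda>w. (\<Sum>g\<in>S. a g * hermite k (X g w))\<^sup>2)"
proof -
  have "(\<lambda>w. (\<Sum>g\<in>S. a g * hermite k (X g w))\<^sup>2)
      = (\<lambda>w. \<Sum>g\<in>S. \<Sum>h\<in>S. (a g * a h) * (hermite k (X g w) * hermite k (X h w)))"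
    by (simp add: power2_eq_square sum_product mult_ac)
  then show ?thesis
    by (auto intro!: Bochner_Integration.integrable_sum integrable_mult_right integrable_hermite_mult assms)
qed

text \<open>The remainders \<open>X (v g)\<close> are independent of \<open>X h\<close>, so by
  Fubini the bound for two polynomials applies with the value \<open>y\<close> of the remainders
  held fixed. It is affine in \<open>gauss_sq\<close>, and \<open>\<alpha>\<close> does not vary
  with \<open>y\<close>; integrating over \<open>y\<close> therefore returns the second moments of
  \<open>F - G\<close> and \<open>F\<close>.\<close>

lemma hermite_sum_test_function_bound:
  assumes C: "test_function_constant k C" and S: "finite S" "\<And>g. g \<in> S \<Longrightarrow> norm g = 1" and h: "norm h = 1"
    and \<alpha>: "(\<Sum>g\<in>S. a g * (g \<bullet> h) ^ k) = \<alpha>" "\<alpha> \<noteq> 0"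
    and \<eta>: "0 < \<eta>" and s: "0 < s" "s \<le> 1"
    and \<phi>: "continuous_on UNIV \<phi>" "\<And>x. \<bar>\<phi> x\<bar> \<le> 1"
    and F: "F = (\<lambda>w. \<Sum>g\<in>S. a g * hermite k (X g w))" and G: "G = (\<lambda>w. \<Sum>g\<in>S. b g * hermite k (X g w))"
  shows "\<bar>expectation (\<lambda>w. \<phi> (F w)) - expectation (\<lambda>w. \<phi> (G w))\<bar>
    \<le> 4 * real k * s + 2 * s / \<alpha>\<^sup>2 + C / s ^ (2 * k - 1) *
       (expectation (\<lambda>w. (F w - G w)\<^sup>2) / \<eta> + \<eta> * (1 + expectation (\<lambda>w. (F w)\<^sup>2)))"
proof -
  have [measurable]: "\<phi> \<in> borel_measurable borel" using \<phi>(1) by (rule borel_measurable_continuous_onI)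
  have Fm [measurable]: "F \<in> borel_measurable M" and Gm [measurable]: "G \<in> borel_measurable M"
    unfolding F G by measurable
  define c where "c g = g \<bullet> h" for g
  define v where "v g = g - c g *\<^sub>R h" for g
  have orth: "h \<bullet> v g = 0" for g
    using h by (simp add: v_def c_def inner_diff_right inner_commute dot_square_norm)
  define B where "B = PiM S (\<lambda>_. borel :: real measure)"
  define Y where "Y = (\<lambda>w. \<lambda>g\<in>S. X (v g) w)"
  have Ym [measurable]: "Y \<in> measurable M B" unfolding Y_def B_def by (intro measurable_restrict) auto
  define \<mu> where "\<mu> = distr M B Y"
  let ?N = "std_normal_distribution"
  have joint: "distr M (borel \<Otimes>\<^sub>M B) (\<lambda>w. (X h w, Y w)) = ?N \<Otimes>\<^sub>M \<mu>"
    unfolding \<mu>_def Y_def B_def by (rule joint_distr_orthogonal[OF S(1) h orth])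
  have [measurable_cong]: "sets \<mu> = sets B" by (simp add: \<mu>_def)
  interpret N: prob_space ?N by (rule prob_space_std_normal)
  interpret \<mu>: prob_space \<mu> unfolding \<mu>_def by (rule prob_space_distr) simp
  interpret P: pair_prob_space ?N \<mu> ..
  \<comment> \<open>Given remainders \<open>y\<close>, this is the Hermite sum with coefficients
    \<open>a\<close> as a polynomial in the value of \<open>X h\<close>.\<close>
  define R where "R a y = (\<Sum>g\<in>S. smult (a g) (pcompose (hermite_poly k) [:y g, c g:]))" for a y
  have poly_R: "poly (R a y) u = (\<Sum>g\<in>S. a g * hermite k (y g + c g * u))" for a y u
    unfolding R_def hermite_eq_poly by (simp add: poly_sum poly_pcompose mult.commute)
  have deg_R: "degree (R a y) \<le> k" for a y
    unfolding R_def
  proof (intro degree_sum_le S)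
    fix g
    have "degree (pcompose (hermite_poly k) [:y g, c g:]) \<le> degree (hermite_poly k) * degree [:y g, c g:]"
      by (rule degree_pcompose_le)
    also have "\<dots> \<le> k * 1" by (intro mult_mono degree_hermite_poly) auto
    finally show "degree (smult (a g) (pcompose (hermite_poly k) [:y g, c g:])) \<le> k"
      using degree_smult_le order_trans by fastforce
  qed
  have coeff_R: "coeff (R a y) k = \<alpha>" for y
    unfolding R_def \<alpha>(1)[symmetric]
    by (simp add: coeff_sum coeff_pcompose_linear degree_hermite_poly coeff_hermite_poly c_def)
  have meas_R: "(\<lambda>(u, y). poly (R a y) u) \<in> borel_measurable (borel \<Otimes>\<^sub>M B)" for a
    unfolding poly_R B_def by measurable
  have split_X: "AE w in M. \<forall>g\<in>S. X g w = X (v g) w + c g * X h w"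
  proof (rule AE_finite_allI[OF S(1)])
    fix g
    have "g = 1 *\<^sub>R v g + c g *\<^sub>R h" by (simp add: v_def)
    then show "AE w in M. X g w = X (v g) w + c g * X h w"
      using X_linear[of 1 "v g" "c g" h] by simp
  qed
  have AE_R: "AE w in M. (\<Sum>g\<in>S. a g * hermite k (X g w)) = poly (R a (Y w)) (X h w)" for a
    using split_X by eventually_elim (simp add: poly_R Y_def cong: sum.cong)
  have transfer: "integrable (?N \<Otimes>\<^sub>M \<mu>) (case_prod f)"
      "expectation H = (\<integral>y. gauss_int (\<lambda>u. f u y) \<partial>\<mu>)" "integrable \<mu> (\<lambda>y. gauss_int (\<lambda>u. f u y))"
    if f: "case_prod f \<in> borel_measurable (borel \<Otimes>\<^sub>M B)" and H: "integrable M H"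
      and eq: "AE w in M. H w = f (X h w) (Y w)" for f and H :: "'w \<Rightarrow> real"
  proof -
    note [measurable] = f
    have pair: "(\<lambda>w. (X h w, Y w)) \<in> measurable M (borel \<Otimes>\<^sub>M B)" by measurable
    have [measurable]: "H \<in> borel_measurable M" using H by simp
    have fm: "(\<lambda>w. case_prod f (X h w, Y w)) \<in> borel_measurable M" by (rule measurable_compose[OF pair f])
    have "integrable M (\<lambda>w. case_prod f (X h w, Y w))"
      using H eq fm by (subst integrable_cong_AE[where g = H]) auto
    then show int: "integrable (?N \<Otimes>\<^sub>M \<mu>) (case_prod f)"
      unfolding joint[symmetric] by (simp add: integrable_distr_eq[OF pair f])
    have "expectation H = expectation (\<lambda>w. case_prod f (X h w, Y w))"
      using eq fm by (intro integral_cong_AE) auto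
    also have "\<dots> = integral\<^sup>L (?N \<Otimes>\<^sub>M \<mu>) (case_prod f)"
      unfolding joint[symmetric] by (rule integral_distr[OF pair f, symmetric])
    also have "\<dots> = (\<integral>y. gauss_int (\<lambda>u. f u y) \<partial>\<mu>)"
      using P.integral_snd[OF int] by simp
    finally show "expectation H = (\<integral>y. gauss_int (\<lambda>u. f u y) \<partial>\<mu>)" .
    show "integrable \<mu> (\<lambda>y. gauss_int (\<lambda>u. f u y))" by (rule P.integrable_snd[OF int])
  qed
  have square: "expectation (\<lambda>w. (\<Sum>g\<in>S. a g * hermite k (X g w))\<^sup>2) = (\<integral>y. gauss_sq (R a y) \<partial>\<mu>)"
      "integrable \<mu> (\<lambda>y. gauss_sq (R a y))" for a
  proof -
    have m: "(\<lambda>(u, y). (poly (R a y) u)\<^sup>2) \<in> borel_measurable (borel \<Otimes>\<^sub>M B)"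
      using meas_R[of a] by (simp add: case_prod_beta')
    have eq: "AE w in M. (\<Sum>g\<in>S. a g * hermite k (X g w))\<^sup>2 = (poly (R a (Y w)) (X h w))\<^sup>2"
      using AE_R[of a] by eventually_elim simp
    note tr = transfer[OF m integrable_hermite_sum_square[OF S(2)] eq]
    show "expectation (\<lambda>w. (\<Sum>g\<in>S. a g * hermite k (X g w))\<^sup>2) = (\<integral>y. gauss_sq (R a y) \<partial>\<mu>)"
      "integrable \<mu> (\<lambda>y. gauss_sq (R a y))"
      using tr(2,3) by (simp_all add: gauss_sq_def)
  qed
  \<comment> \<open>Because \<open>R\<close> is linear in the coefficients, \<open>square\<close>
    also covers the difference \<open>F - G\<close>.\<close>
  have R_diff: "R a y - R b y = R (\<lambda>g. a g - b g) y" for y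
    unfolding R_def by (simp add: sum_subtractf smult_diff_left)
  have EFG: "expectation (\<lambda>w. (F w - G w)\<^sup>2) = (\<integral>y. gauss_sq (R a y - R b y) \<partial>\<mu>)"
    and iFG: "integrable \<mu> (\<lambda>y. gauss_sq (R a y - R b y))"
    using square[of "\<lambda>g. a g - b g"] unfolding R_diff F G
    by (simp_all add: sum_subtractf left_diff_distrib)
  have EF: "expectation (\<lambda>w. (F w)\<^sup>2) = (\<integral>y. gauss_sq (R a y) \<partial>\<mu>)" and iF: "integrable \<mu> (\<lambda>y. gauss_sq (R a y))"
    using square[of a] unfolding F by simp_all
  define f where "f u y = \<phi> (poly (R a y) u) - \<phi> (poly (R b y) u)" for u y
  have fm: "case_prod f \<in> borel_measurable (borel \<Otimes>\<^sub>M B)"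
    unfolding f_def case_prod_beta'
    by (intro borel_measurable_diff measurable_compose[OF meas_R[unfolded case_prod_beta']]) auto
  have int\<phi>: "integrable M (\<lambda>w. \<phi> (F w))" "integrable M (\<lambda>w. \<phi> (G w))"
    by (rule integrable_const_bound[where B = 1]; auto simp: \<phi>(2))+
  have eqf: "AE w in M. \<phi> (F w) - \<phi> (G w) = f (X h w) (Y w)"
    using AE_R[of a] AE_R[of b] unfolding F G by eventually_elim (simp add: f_def)
  note tf = transfer[OF fm Bochner_Integration.integrable_diff[OF int\<phi>] eqf]
  let ?b = "\<lambda>y. 4 * real k * s + 2 * s / \<alpha>\<^sup>2 + C / s ^ (2 * k - 1) *
       (gauss_sq (R a y - R b y) / \<eta> + \<eta> * (1 + gauss_sq (R a y)))"
  have ib: "integrable \<mu> ?b"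
    using iFG iF by (intro Bochner_Integration.integrable_add integrable_mult_right integrable_divide) auto
  have le: "\<bar>gauss_int (\<lambda>u. f u y)\<bar> \<le> ?b y" for y
    unfolding f_def by (rule test_function_constantD[OF C deg_R deg_R coeff_R \<alpha>(2) \<eta> s \<phi>])
  have "\<bar>expectation (\<lambda>w. \<phi> (F w)) - expectation (\<lambda>w. \<phi> (G w))\<bar> = \<bar>\<integral>y. gauss_int (\<lambda>u. f u y) \<partial>\<mu>\<bar>"
    using tf(2) int\<phi> by simp
  also have "\<dots> \<le> (\<integral>y. ?b y \<partial>\<mu>)"
    by (rule order_trans[OF integral_abs_bound integral_mono]) (intro integrable_abs tf(3) ib le)+
  also have "\<dots> = 4 * real k * s + 2 * s / \<alpha>\<^sup>2 + C / s ^ (2 * k - 1) *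
       ((\<integral>y. gauss_sq (R a y - R b y) \<partial>\<mu>) / \<eta> + \<eta> * (1 + (\<integral>y. gauss_sq (R a y) \<partial>\<mu>)))"
    using iF iFG \<mu>.prob_space by simp
  finally show ?thesis by (simp only: EF EFG)
qed

end

section \<open>Total variation distance on a Wiener chaos\<close>

lemma closed_inner_approximation:
  fixes \<mu> :: "real measure"
  assumes "finite_measure \<mu>" and sets: "sets \<mu> = sets borel" and A: "A \<in> sets borel" and e: "e > 0"
  shows "\<exists>K\<subseteq>A. closed K \<and> measure \<mu> A < measure \<mu> K + e"
proof (rule ccontr)
  interpret finite_measure \<mu> by fact
  assume "\<not> ?thesis"
  then have le: "measure \<mu> K \<le> measure \<mu> A - e" if "K \<subseteq> A" "compact K" for K
    using that compact_imp_closed[OF that(2)] by force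
  have "emeasure \<mu> A = (SUP K\<in>{K. K \<subseteq> A \<and> compact K}. emeasure \<mu> K)"
    using A by (intro inner_regular) (auto simp: sets emeasure_finite)
  also have "\<dots> \<le> ennreal (measure \<mu> A - e)"
    by (rule SUP_least) (auto simp: emeasure_eq_measure intro: le ennreal_leI)
  \<comment> \<open>The empty set shows that \<open>measure \<mu> A - e\<close> is nonnegative, so
    nothing is lost in the passage through \<open>ennreal\<close>.\<close>
  finally have "measure \<mu> A \<le> measure \<mu> A - e"
    using le[of "{}"] by (simp add: emeasure_eq_measure)
  then show False using e by simp
qed

context prob_space
begin

text \<open>\<open>B\<close> must not depend on \<open>L\<close>, since the cut-offs approximating
  the indicator of a closed set have Lipschitz constants tending to infinity. Dominated convergence
  then handles closed sets, and inner regularity all Borel sets.\<close>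

lemma tv_dist_le_lipschitz_tests:
  assumes Fm [measurable]: "F \<in> borel_measurable M" and Gm [measurable]: "G \<in> borel_measurable M"
    and bound: "\<And>\<phi> L. (\<And>x y. \<bar>\<phi> x - \<phi> y\<bar> \<le> L * \<bar>x - y\<bar>) \<Longrightarrow> (\<And>x. \<bar>\<phi> x\<bar> \<le> 1) \<Longrightarrow>
      \<bar>expectation (\<lambda>w. \<phi> (F w)) - expectation (\<lambda>w. \<phi> (G w))\<bar> \<le> B"
  shows "tv_dist M F G \<le> B"
proof -
  define \<mu> where "\<mu> = distr M borel F"
  define \<nu> where "\<nu> = distr M borel G"
  interpret \<mu>: prob_space \<mu> unfolding \<mu>_def by (rule prob_space_distr) simp
  interpret \<nu>: prob_space \<nu> unfolding \<nu>_def by (rule prob_space_distr) simp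
  have [simp]: "sets \<mu> = sets borel" "sets \<nu> = sets borel" by (simp_all add: \<mu>_def \<nu>_def)
  have B0: "0 \<le> B" using bound[of "\<lambda>_. 0" 0] by simp
  have closed_case: "\<bar>measure \<mu> K - measure \<nu> K\<bar> \<le> B" if K: "closed K" for K :: "real set"
  proof (cases "K = {}")
    case True
    then show ?thesis using B0 by simp
  next
    case False
    \<comment> \<open>Nonemptiness of \<open>K\<close> matters: \<open>infdist\<close> to the empty
      set is 0, so these cut-offs would be constantly 1 there.\<close>
    define \<phi> where "\<phi> m x = max 0 (1 - real m * infdist x K)" for m x
    have Kb [measurable]: "K \<in> sets borel" using K by simp
    have b1: "\<bar>\<phi> m x\<bar> \<le> 1" for m x by (auto simp: \<phi>_def infdist_nonneg)
    have lip: "\<bar>\<phi> m x - \<phi> m y\<bar> \<le> real m * \<bar>x - y\<bar>" for m x y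
    proof -
      have "\<bar>\<phi> m x - \<phi> m y\<bar> \<le> \<bar>real m * infdist x K - real m * infdist y K\<bar>"
        by (auto simp: \<phi>_def max_def)
      also have "\<dots> = real m * \<bar>infdist x K - infdist y K\<bar>"
        by (simp add: abs_mult flip: right_diff_distrib)
      also have "\<dots> \<le> real m * \<bar>x - y\<bar>"
        using infdist_triangle_abs[of x K y] by (intro mult_left_mono) (auto simp: dist_real_def)
      finally show ?thesis .
    qed
    have [measurable]: "\<phi> m \<in> borel_measurable borel" for m
      unfolding \<phi>_def by (intro borel_measurable_continuous_onI continuous_intros)
    have lim: "(\<lambda>m. \<phi> m x) \<longlonglongrightarrow> indicat_real K x" for x
    proof (cases "x \<in> K")
      case True
      then show ?thesis by (simp add: \<phi>_def)
    next
      case out: False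
      then have d: "infdist x K > 0"
        using in_closed_iff_infdist_zero[OF K False, of x] infdist_nonneg[of x K] by linarith
      have "\<forall>\<^sub>F m in sequentially. \<phi> m x = 0"
        using eventually_ge_at_top[of "nat \<lceil>1 / infdist x K\<rceil>"]
      proof eventually_elim
        case (elim m)
        then have "1 / infdist x K \<le> real m" by linarith
        then have "1 \<le> real m * infdist x K" using d by (simp add: field_simps)
        then show ?case by (simp add: \<phi>_def)
      qed
      then show ?thesis using out by (simp add: tendsto_eventually)
    qed
    have conv: "(\<lambda>m. expectation (\<lambda>w. \<phi> m (H w))) \<longlonglongrightarrow> measure (distr M borel H) K"
      if [measurable]: "H \<in> borel_measurable M" for H
    proof -
      have "(\<lambda>m. expectation (\<lambda>w. \<phi> m (H w))) \<longlonglongrightarrow> expectation (\<lambda>w. indicat_real K (H w))"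
        by (rule integral_dominated_convergence[where w = "\<lambda>_. 1"]) (auto simp: lim b1)
      also have "expectation (\<lambda>w. indicat_real K (H w)) = measure (distr M borel H) K"
        using integral_distr[of H M borel "indicat_real K"] by simp
      finally show ?thesis .
    qed
    have "(\<lambda>m. \<bar>expectation (\<lambda>w. \<phi> m (F w)) - expectation (\<lambda>w. \<phi> m (G w))\<bar>) \<longlonglongrightarrow> \<bar>measure \<mu> K - measure \<nu> K\<bar>"
      unfolding \<mu>_def \<nu>_def by (intro tendsto_rabs tendsto_diff conv) auto
    then show ?thesis
      by (rule LIMSEQ_le_const2) (use bound[OF lip b1] in blast)
  qed
  have "\<bar>measure \<mu> A - measure \<nu> A\<bar> \<le> B" if A: "A \<in> sets borel" for A
  proof (rule field_le_epsilon)
    fix e :: real assume e: "e > 0"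
    obtain K1 where K1: "K1 \<subseteq> A" "closed K1" "measure \<mu> A < measure \<mu> K1 + e"
      using closed_inner_approximation[of \<mu> A e] A e \<mu>.finite_measure_axioms by (auto simp: \<mu>_def)
    obtain K2 where K2: "K2 \<subseteq> A" "closed K2" "measure \<nu> A < measure \<nu> K2 + e"
      using closed_inner_approximation[of \<nu> A e] A e \<nu>.finite_measure_axioms by (auto simp: \<nu>_def)
    \<comment> \<open>Each law comes with its own closed approximation; their union still lies
      inside \<open>A\<close> and is good for both.\<close>
    let ?K = "K1 \<union> K2"
    have "measure \<mu> K1 \<le> measure \<mu> ?K" "measure \<mu> ?K \<le> measure \<mu> A"
      using K1 K2 A by (auto intro!: \<mu>.finite_measure_mono)
    moreover have "measure \<nu> K2 \<le> measure \<nu> ?K" "measure \<nu> ?K \<le> measure \<nu> A"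
      using K1 K2 A by (auto intro!: \<nu>.finite_measure_mono)
    moreover have "\<bar>measure \<mu> ?K - measure \<nu> ?K\<bar> \<le> B" using K1 K2 by (intro closed_case) auto
    ultimately show "\<bar>measure \<mu> A - measure \<nu> A\<bar> \<le> B + e" using K1(3) K2(3) by linarith
  qed
  moreover have "measure \<mu> A = prob {w \<in> space M. F w \<in> A}" "measure \<nu> A = prob {w \<in> space M. G w \<in> A}"
    if "A \<in> sets borel" for A
    using that by (auto simp: \<mu>_def \<nu>_def measure_distr vimage_def Int_def conj_commute)
  ultimately show ?thesis
    unfolding tv_dist_def by (intro cSUP_least) auto
qed

lemma tv_dist_le_1: "tv_dist M F G \<le> 1"
  unfolding tv_dist_def
proof (rule cSUP_least)
  show "\<bar>prob {w \<in> space M. F w \<in> A} - prob {w \<in> space M. G w \<in> A}\<bar> \<le> 1" for A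
    using prob_le_1[of "{w \<in> space M. F w \<in> A}"] prob_le_1[of "{w \<in> space M. G w \<in> A}"]
      measure_nonneg[of M "{w \<in> space M. F w \<in> A}"] measure_nonneg[of M "{w \<in> space M. G w \<in> A}"]
    by linarith
qed auto

section \<open>Estimates for square-integrable variables\<close>

lemma square_integrable_mult:
  assumes "square_integrable M F" "square_integrable M G"
  shows "integrable M (\<lambda>w. F w * G w)"
proof (rule Bochner_Integration.integrable_bound)
  show "integrable M (\<lambda>w. (F w)\<^sup>2 + (G w)\<^sup>2)"
    using assms by (auto simp: square_integrable_def)
  show "(\<lambda>w. F w * G w) \<in> borel_measurable M"
    using assms by (auto simp: square_integrable_def)
  show "AE w in M. norm (F w * G w) \<le> norm ((F w)\<^sup>2 + (G w)\<^sup>2)"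
    using abs_mult_le_sum_squares by (intro AE_I2) (simp add: abs_mult)
qed

lemma square_integrable_diff:
  assumes F: "square_integrable M F" and G: "square_integrable M G"
  shows "square_integrable M (\<lambda>w. F w - G w)"
proof -
  have "(\<lambda>w. (F w - G w)\<^sup>2) = (\<lambda>w. (F w)\<^sup>2 + (G w)\<^sup>2 - 2 * (F w * G w))"
    by (simp add: power2_diff fun_eq_iff)
  then show ?thesis
    using F G square_integrable_mult[OF F G] by (auto simp: square_integrable_def)
qed

text \<open>A weighted arithmetic-geometric mean inequality in the role of Cauchy-Schwarz: the
  result is linear in \<open>\<tau>\<close>, at the price of the factor
  \<open>(1 + expectation (\<lambda>w. (G w)\<^sup>2)) / 2\<close>, which is 1 for
  \<open>G = 1\<close>.\<close>

lemma expectation_mult_le: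
  assumes F: "square_integrable M F" and G: "square_integrable M G" and \<tau>: "\<tau> > 0"
    and le: "expectation (\<lambda>w. (F w)\<^sup>2) \<le> \<tau>\<^sup>2"
  shows "expectation (\<lambda>w. \<bar>F w * G w\<bar>) \<le> \<tau> * (1 + expectation (\<lambda>w. (G w)\<^sup>2)) / 2"
proof -
  have i: "integrable M (\<lambda>w. (F w)\<^sup>2)" "integrable M (\<lambda>w. (G w)\<^sup>2)"
    using F G by (auto simp: square_integrable_def)
  have "expectation (\<lambda>w. \<bar>F w * G w\<bar>) \<le> expectation (\<lambda>w. 1 / (2 * \<tau>) * (F w)\<^sup>2 + \<tau> / 2 * (G w)\<^sup>2)"
  proof (rule integral_mono)
    show "integrable M (\<lambda>w. \<bar>F w * G w\<bar>)" using square_integrable_mult[OF F G] by (rule integrable_abs)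
    show "integrable M (\<lambda>w. 1 / (2 * \<tau>) * (F w)\<^sup>2 + \<tau> / 2 * (G w)\<^sup>2)"
      using i by (intro Bochner_Integration.integrable_add integrable_mult_right)
    fix w
    have "0 \<le> (\<bar>F w\<bar> - \<tau> * \<bar>G w\<bar>)\<^sup>2 / (2 * \<tau>)" using \<tau> by simp
    also have "\<dots> = 1 / (2 * \<tau>) * (F w)\<^sup>2 + \<tau> / 2 * (G w)\<^sup>2 - \<bar>F w * G w\<bar>"
      using \<tau> by (simp add: power2_diff power_mult_distrib abs_mult field_simps power2_eq_square)
    finally show "\<bar>F w * G w\<bar> \<le> 1 / (2 * \<tau>) * (F w)\<^sup>2 + \<tau> / 2 * (G w)\<^sup>2" by simp
  qed
  also have "\<dots> = 1 / (2 * \<tau>) * expectation (\<lambda>w. (F w)\<^sup>2) + \<tau> / 2 * expectation (\<lambda>w. (G w)\<^sup>2)"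
    using i by (simp only: Bochner_Integration.integral_add integrable_mult_right integral_mult_right_zero)
  also have "\<dots> \<le> 1 / (2 * \<tau>) * \<tau>\<^sup>2 + \<tau> / 2 * expectation (\<lambda>w. (G w)\<^sup>2)"
    using le \<tau> by (intro add_mono mult_left_mono) auto
  also have "\<dots> = \<tau> * (1 + expectation (\<lambda>w. (G w)\<^sup>2)) / 2"
    using \<tau> by (simp add: power2_eq_square field_simps)
  finally show ?thesis .
qed

lemma lipschitz_expectation_diff_le:
  assumes F: "square_integrable M F" and G: "square_integrable M G" and \<tau>: "\<tau> > 0"
    and le: "expectation (\<lambda>w. (F w - G w)\<^sup>2) \<le> \<tau>\<^sup>2"
    and lip: "\<And>x y. \<bar>\<phi> x - \<phi> y\<bar> \<le> L * \<bar>x - y\<bar>" and bd: "\<And>x. \<bar>\<phi> x\<bar> \<le> 1" and L: "L \<ge> 0"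
    and [measurable]: "\<phi> \<in> borel_measurable borel"
  shows "\<bar>expectation (\<lambda>w. \<phi> (F w)) - expectation (\<lambda>w. \<phi> (G w))\<bar> \<le> L * \<tau>"
proof -
  have [measurable]: "F \<in> borel_measurable M" "G \<in> borel_measurable M"
    using F G by (auto simp: square_integrable_def)
  have one: "square_integrable M (\<lambda>_. 1)" by (simp add: square_integrable_def)
  have D: "square_integrable M (\<lambda>w. F w - G w)" by (rule square_integrable_diff[OF F G])
  have int: "integrable M (\<lambda>w. \<phi> (F w))" "integrable M (\<lambda>w. \<phi> (G w))"
    by (rule integrable_const_bound[where B = 1]; auto simp: bd)+
  have intD: "integrable M (\<lambda>w. \<bar>F w - G w\<bar>)"
    using square_integrable_mult[OF D one] by simp
  have "\<bar>expectation (\<lambda>w. \<phi> (F w)) - expectation (\<lambda>w. \<phi> (G w))\<bar> = \<bar>expectation (\<lambda>w. \<phi> (F w) - \<phi> (G w))\<bar>"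
    using int by simp
  also have "\<dots> \<le> expectation (\<lambda>w. L * \<bar>F w - G w\<bar>)"
    by (rule order_trans[OF integral_abs_bound integral_mono])
       (intro integrable_abs Bochner_Integration.integrable_diff integrable_mult_right int intD lip)+
  also have "\<dots> = L * expectation (\<lambda>w. \<bar>(F w - G w) * 1\<bar>)" by simp
  also have "\<dots> \<le> L * (\<tau> * (1 + expectation (\<lambda>_. 1\<^sup>2)) / 2)"
    by (intro mult_left_mono expectation_mult_le D one \<tau> le L)
  also have "\<dots> = L * \<tau>" by (simp add: prob_space)
  finally show ?thesis .
qed

end

section \<open>Symmetric tensors and approximation in the chaos\<close>

lemma diagonal_tensor_symmetric: "t (\<lambda>_. h) \<in> symmetric_tensor_power k t"
proof -
  have "symmetrized_tensor k t (\<lambda>_. h) = t (\<lambda>_. h)"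
    by (simp add: symmetrized_tensor_def o_def sum_constant_scaleR card_permutations[OF refl])
  then show ?thesis
    unfolding symmetric_tensor_power_def
    by (metis closure_subset rangeI span_base subsetD)
qed

lemma subspace_closure_real_normed:
  fixes S :: "'a::real_normed_vector set"
  assumes "subspace S"
  shows "subspace (closure S)"
proof (rule subspaceI)
  show "0 \<in> closure S" using subspace_0[OF assms] closure_subset by blast
  show "x + y \<in> closure S" if "x \<in> closure S" "y \<in> closure S" for x y
  proof -
    note xy = that
    obtain u v where "\<forall>n. u n \<in> S" "u \<longlonglongrightarrow> x" "\<forall>n. v n \<in> S" "v \<longlonglongrightarrow> y"
      using xy unfolding closure_sequential by blast
    then show ?thesis unfolding closure_sequential
      by (intro exI[of _ "\<lambda>n. u n + v n"] conjI allI tendsto_add subspace_add[OF assms]) auto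
  qed
  show "a *\<^sub>R x \<in> closure S" if "x \<in> closure S" for a x
  proof -
    note x = that
    obtain u where "\<forall>n. u n \<in> S" "u \<longlonglongrightarrow> x" using x unfolding closure_sequential by blast
    then show ?thesis unfolding closure_sequential
      by (intro exI[of _ "\<lambda>n. a *\<^sub>R u n"] conjI allI tendsto_scaleR tendsto_const subspace_scale[OF assms]) auto
  qed
qed

lemma subspace_symmetric_tensor_power: "subspace (symmetric_tensor_power k t)"
  unfolding symmetric_tensor_power_def by (intro subspace_closure_real_normed subspace_span)

context isonormal_process
begin

lemma hermite_sum_square_integrable:
  assumes "\<And>g. g \<in> S \<Longrightarrow> norm g = 1"
  shows "square_integrable M (\<lambda>w. \<Sum>g\<in>S. a g * hermite k (X g w))"
  unfolding square_integrable_def using integrable_hermite_sum_square[OF assms] by simp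

lemma wiener_chaos_approximation:
  assumes "F \<in> wiener_chaos k M X" and "\<tau> > 0"
  shows "\<exists>S a. finite S \<and> (\<forall>g\<in>S. norm g = 1) \<and>
    expectation (\<lambda>w. (F w - (\<Sum>g\<in>S. a g * hermite k (X g w)))\<^sup>2) \<le> \<tau>\<^sup>2"
proof -
  obtain S a where S: "finite S" "\<forall>h\<in>S. norm h = 1"
    and lt: "L2_norm M (\<lambda>w. F w - (\<Sum>h\<in>S. a h * hermite k (X h w))) < \<tau>"
    using assms by (auto simp: wiener_chaos_def)
  have "expectation (\<lambda>w. (F w - (\<Sum>g\<in>S. a g * hermite k (X g w)))\<^sup>2)
      = (L2_norm M (\<lambda>w. F w - (\<Sum>h\<in>S. a h * hermite k (X h w))))\<^sup>2"
    unfolding L2_norm_def by simp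
  also have "\<dots> \<le> \<tau>\<^sup>2" using lt by (intro power_mono) (auto simp: L2_norm_def)
  finally show ?thesis using S by blast
qed

end

section \<open>The multiple integral as an isometry\<close>

locale wiener_integral = isonormal_process M X
  for M :: "'w measure" and X :: "'h::{real_inner, complete_space} \<Rightarrow> 'w \<Rightarrow> real" +
  fixes k :: nat and t :: "(nat \<Rightarrow> 'h) \<Rightarrow> 't::{real_inner, complete_space}" and I :: "'t \<Rightarrow> 'w \<Rightarrow> real"
  assumes tensor: "hilbert_tensor_power k t" and integral: "multiple_wiener_integral k t M X I"
begin

lemma I_chaos: "f \<in> symmetric_tensor_power k t \<Longrightarrow> I f \<in> wiener_chaos k M X"
  using integral by (simp add: multiple_wiener_integral_def)

lemma I_square_integrable: "f \<in> symmetric_tensor_power k t \<Longrightarrow> square_integrable M (I f)"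
  using I_chaos by (auto simp: wiener_chaos_def)

lemma I_linear: "f \<in> symmetric_tensor_power k t \<Longrightarrow> g \<in> symmetric_tensor_power k t \<Longrightarrow>
    AE w in M. I (a *\<^sub>R f + b *\<^sub>R g) w = a * I f w + b * I g w"
  using integral by (simp add: multiple_wiener_integral_def)

lemma I_isometry:
  assumes "f \<in> symmetric_tensor_power k t"
  shows "expectation (\<lambda>w. (I f w)\<^sup>2) = fact k * (norm f)\<^sup>2"
proof -
  have "sqrt (expectation (\<lambda>w. (I f w)\<^sup>2)) = sqrt (fact k) * norm f"
    using integral assms by (simp add: multiple_wiener_integral_def L2_norm_def)
  then have "(sqrt (expectation (\<lambda>w. (I f w)\<^sup>2)))\<^sup>2 = (sqrt (fact k) * norm f)\<^sup>2" by simp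
  then show ?thesis by (simp add: power_mult_distrib)
qed

text \<open>Polarisation of \<open>I_isometry\<close>, using that \<open>I\<close> is additive
  almost surely.\<close>

lemma I_inner:
  assumes f: "f \<in> symmetric_tensor_power k t" and g: "g \<in> symmetric_tensor_power k t"
  shows "expectation (\<lambda>w. I f w * I g w) = fact k * (f \<bullet> g)"
proof -
  have fg: "1 *\<^sub>R f + 1 *\<^sub>R g \<in> symmetric_tensor_power k t"
    using subspace_symmetric_tensor_power f g by (intro subspace_add subspace_scale)
  note sq = I_square_integrable[OF f] I_square_integrable[OF g] I_square_integrable[OF fg]
  have [measurable]: "I f \<in> borel_measurable M" "I g \<in> borel_measurable M" "I (f + g) \<in> borel_measurable M"
    and i: "integrable M (\<lambda>w. (I f w)\<^sup>2)" "integrable M (\<lambda>w. (I g w)\<^sup>2)"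
    using sq by (auto simp: square_integrable_def)
  have "fact k * (norm (f + g))\<^sup>2 = expectation (\<lambda>w. (I (f + g) w)\<^sup>2)"
    using I_isometry[OF fg] by simp
  also have "\<dots> = expectation (\<lambda>w. (I f w)\<^sup>2 + (I g w)\<^sup>2 + 2 * (I f w * I g w))"
    using I_linear[OF f g, of 1 1] by (intro integral_cong_AE) (auto simp: power2_sum)
  also have "\<dots> = fact k * (norm f)\<^sup>2 + fact k * (norm g)\<^sup>2 + 2 * expectation (\<lambda>w. I f w * I g w)"
    using i square_integrable_mult[OF sq(1,2)] by (simp add: I_isometry f g)
  finally show ?thesis
    by (simp add: power2_norm_eq_inner inner_add_left inner_add_right inner_commute algebra_simps)
qed

lemma I_diagonal: "norm h = 1 \<Longrightarrow> AE w in M. I (t (\<lambda>_. h)) w = hermite k (X h w)"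
  using integral by (simp add: multiple_wiener_integral_def)

lemma expectation_I_hermite:
  assumes f: "f \<in> symmetric_tensor_power k t" and h: "norm h = 1"
  shows "expectation (\<lambda>w. I f w * hermite k (X h w)) = fact k * (f \<bullet> t (\<lambda>_. h))"
proof -
  have [measurable]: "I f \<in> borel_measurable M" "I (t (\<lambda>_. h)) \<in> borel_measurable M"
    using I_square_integrable[OF f] I_square_integrable[OF diagonal_tensor_symmetric]
    by (auto simp: square_integrable_def)
  have "expectation (\<lambda>w. I f w * hermite k (X h w)) = expectation (\<lambda>w. I f w * I (t (\<lambda>_. h)) w)"
    using I_diagonal[OF h] by (intro integral_cong_AE) auto
  then show ?thesis by (simp add: I_inner[OF f diagonal_tensor_symmetric])
qed

text \<open>The orthogonality relation is read off the isometry on diagonal tensors, which avoids a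
  computation with jointly Gaussian variables.\<close>

lemma expectation_hermite_hermite:
  assumes g: "norm g = 1" and h: "norm h = 1"
  shows "expectation (\<lambda>w. hermite k (X g w) * hermite k (X h w)) = fact k * (g \<bullet> h) ^ k"
proof -
  have [measurable]: "I (t (\<lambda>_. g)) \<in> borel_measurable M"
    using I_square_integrable[OF diagonal_tensor_symmetric] by (auto simp: square_integrable_def)
  have "expectation (\<lambda>w. hermite k (X g w) * hermite k (X h w))
      = expectation (\<lambda>w. I (t (\<lambda>_. g)) w * hermite k (X h w))"
    using I_diagonal[OF g] by (intro integral_cong_AE) auto
  also have "\<dots> = fact k * (t (\<lambda>_. g) \<bullet> t (\<lambda>_. h))"
    by (rule expectation_I_hermite[OF diagonal_tensor_symmetric h])
  also have "t (\<lambda>_. g) \<bullet> t (\<lambda>_. h) = (g \<bullet> h) ^ k"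
    using tensor by (simp add: hilbert_tensor_power_def)
  finally show ?thesis .
qed

lemma expectation_hermite_sum_hermite:
  assumes S: "\<And>g. g \<in> S \<Longrightarrow> norm g = 1" and h: "norm h = 1"
  shows "expectation (\<lambda>w. (\<Sum>g\<in>S. a g * hermite k (X g w)) * hermite k (X h w))
    = fact k * (\<Sum>g\<in>S. a g * (g \<bullet> h) ^ k)"
proof -
  have "expectation (\<lambda>w. (\<Sum>g\<in>S. a g * hermite k (X g w)) * hermite k (X h w))
      = expectation (\<lambda>w. \<Sum>g\<in>S. a g * (hermite k (X g w) * hermite k (X h w)))"
    by (simp add: sum_distrib_right mult.assoc)
  also have "\<dots> = (\<Sum>g\<in>S. a g * expectation (\<lambda>w. hermite k (X g w) * hermite k (X h w)))"
    by (subst Bochner_Integration.integral_sum) (auto intro!: integrable_mult_right integrable_hermite_mult S h)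
  also have "\<dots> = (\<Sum>g\<in>S. a g * (fact k * (g \<bullet> h) ^ k))"
    by (intro sum.cong refl) (simp add: expectation_hermite_hermite S h)
  finally show ?thesis by (simp add: sum_distrib_left mult_ac)
qed

text \<open>If every pairing vanished, \<open>I f\<close> would be orthogonal to all Hermite sums
  \<open>F\<close>, so each would miss it by at least \<open>A\<close>, the second moment of
  \<open>I f\<close>. Yet sums with squared error at most \<open>A / 2\<close> exist by definition
  of the chaos.\<close>

lemma ex_nonzero_diagonal_coefficient:
  assumes f: "f \<in> symmetric_tensor_power k t" and nz: "f \<noteq> 0"
  shows "\<exists>h. norm h = 1 \<and> f \<bullet> t (\<lambda>_. h) \<noteq> 0"
proof (rule ccontr)
  assume "\<not> ?thesis"
  then have zero: "f \<bullet> t (\<lambda>_. h) = 0" if "norm h = 1" for h using that by blast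
  have If: "square_integrable M (I f)" by (rule I_square_integrable[OF f])
  define A where "A = fact k * (norm f)\<^sup>2"
  have A: "A > 0" using nz by (simp add: A_def)
  have pos: "sqrt (A / 2) > 0" using A by simp
  obtain S a where S: "finite S" "\<forall>g\<in>S. norm g = 1"
    and le: "expectation (\<lambda>w. (I f w - (\<Sum>g\<in>S. a g * hermite k (X g w)))\<^sup>2) \<le> (sqrt (A / 2))\<^sup>2"
    using wiener_chaos_approximation[OF I_chaos[OF f] pos] by blast
  define F where "F = (\<lambda>w. \<Sum>g\<in>S. a g * hermite k (X g w))"
  have F: "square_integrable M F" unfolding F_def by (rule hermite_sum_square_integrable) (use S in blast)
  have iH: "integrable M (\<lambda>w. I f w * hermite k (X h w))" if "norm h = 1" for h
    using square_integrable_mult[OF If] hermite_sum_square_integrable[of "{h}" "\<lambda>_. 1" k] that by simp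
  have "expectation (\<lambda>w. I f w * F w) = expectation (\<lambda>w. \<Sum>g\<in>S. a g * (I f w * hermite k (X g w)))"
    by (simp add: F_def sum_distrib_left mult_ac)
  also have "\<dots> = (\<Sum>g\<in>S. a g * expectation (\<lambda>w. I f w * hermite k (X g w)))"
    by (subst Bochner_Integration.integral_sum) (use S in \<open>auto intro!: integrable_mult_right iH\<close>)
  also have "\<dots> = 0" by (intro sum.neutral ballI) (use S in \<open>simp add: expectation_I_hermite[OF f] zero\<close>)
  finally have orth: "expectation (\<lambda>w. I f w * F w) = 0" .
  have i: "integrable M (\<lambda>w. (I f w)\<^sup>2)" "integrable M (\<lambda>w. (F w)\<^sup>2)"
    using If F by (auto simp: square_integrable_def)
  have "A + expectation (\<lambda>w. (F w)\<^sup>2) = expectation (\<lambda>w. (I f w)\<^sup>2 + (F w)\<^sup>2 - 2 * (I f w * F w))"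
    using i square_integrable_mult[OF If F] orth by (simp add: I_isometry[OF f] A_def)
  also have "\<dots> = expectation (\<lambda>w. (I f w - F w)\<^sup>2)"
    by (simp add: power2_diff mult.assoc)
  also have "\<dots> \<le> A / 2" using le A by (simp add: F_def)
  finally have "A + expectation (\<lambda>w. (F w)\<^sup>2) \<le> A / 2" .
  moreover have "0 \<le> expectation (\<lambda>w. (F w)\<^sup>2)" by (rule Bochner_Integration.integral_nonneg) simp
  ultimately show False using A by simp
qed

end

text \<open>The summand 2 pays for replacing both integrals by Hermite sums.
  \<open>4 * real k\<close> and \<open>8 / \<alpha>\<^sup>2\<close> come from small values of the
  derivative, the 8 being 2 times 4 because the sum's leading coefficient is only known to be at
  least \<open>\<bar>\<alpha>\<bar> / 2\<close>. With \<open>r\<close> the norm of the limit tensor,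
  \<open>3 * (fact k + 2)\<close> bounds the second moment of \<open>F - G\<close> divided by
  \<open>\<eta>\<^sup>2\<close>, and \<open>3 + 2 * fact k * r\<^sup>2\<close> bounds 1 plus that of
  \<open>F\<close>.\<close>

definition tv_constant :: "nat \<Rightarrow> real \<Rightarrow> real \<Rightarrow> real \<Rightarrow> real" where
  "tv_constant k C \<alpha> r = 2 + 4 * real k + 8 / \<alpha>\<^sup>2 + C * (3 * (fact k + 2) + (3 + 2 * fact k * r\<^sup>2))"

context wiener_integral
begin

lemma I_diff_square:
  assumes f: "f \<in> symmetric_tensor_power k t" and g: "g \<in> symmetric_tensor_power k t"
  shows "expectation (\<lambda>w. (I f w - I g w)\<^sup>2) = fact k * (norm (f - g))\<^sup>2"
proof -
  have fg: "1 *\<^sub>R f + (-1) *\<^sub>R g \<in> symmetric_tensor_power k t"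
    using subspace_symmetric_tensor_power f g by (intro subspace_add subspace_scale)
  have [measurable]: "I f \<in> borel_measurable M" "I g \<in> borel_measurable M" "I (f - g) \<in> borel_measurable M"
    using I_square_integrable[OF f] I_square_integrable[OF g] I_square_integrable[OF fg]
    by (auto simp: square_integrable_def)
  have "expectation (\<lambda>w. (I f w - I g w)\<^sup>2) = expectation (\<lambda>w. (I (f - g) w)\<^sup>2)"
    using I_linear[OF f g, of 1 "-1"] by (intro integral_cong_AE) auto
  then show ?thesis using I_isometry[OF fg] by simp
qed

text \<open>Both coefficients are the same functional, the expectation against
  \<open>hermite k (X h)\<close> divided by \<open>fact k\<close>, applied to \<open>I f\<close> and
  to the sum. Since that Hermite variable has second moment \<open>fact k\<close> and
  \<open>(1 + fact k) / 2 \<le> fact k\<close>, the error is at most \<open>\<tau>\<close>.\<close>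

lemma diagonal_coefficient_approximation:
  assumes f: "f \<in> symmetric_tensor_power k t" and h: "norm h = 1"
    and S: "\<And>g. g \<in> S \<Longrightarrow> norm g = 1" and \<tau>: "\<tau> > 0"
    and le: "expectation (\<lambda>w. (I f w - (\<Sum>g\<in>S. a g * hermite k (X g w)))\<^sup>2) \<le> \<tau>\<^sup>2"
  shows "\<bar>f \<bullet> t (\<lambda>_. h) - (\<Sum>g\<in>S. a g * (g \<bullet> h) ^ k)\<bar> \<le> \<tau>"
proof -
  define F where "F = (\<lambda>w. \<Sum>g\<in>S. a g * hermite k (X g w))"
  let ?H = "\<lambda>w. hermite k (X h w)"
  have F: "square_integrable M F" unfolding F_def by (rule hermite_sum_square_integrable[OF S])
  have H: "square_integrable M ?H"
    using hermite_sum_square_integrable[of "{h}" "\<lambda>_. 1" k] h by simp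
  note If = I_square_integrable[OF f]
  have EH: "expectation (\<lambda>w. (?H w)\<^sup>2) = fact k"
    using expectation_hermite_hermite[OF h h] h by (simp add: power2_eq_square dot_square_norm)
  have "fact k * (f \<bullet> t (\<lambda>_. h) - (\<Sum>g\<in>S. a g * (g \<bullet> h) ^ k))
      = expectation (\<lambda>w. I f w * ?H w) - expectation (\<lambda>w. F w * ?H w)"
    unfolding F_def by (simp add: expectation_I_hermite[OF f h] expectation_hermite_sum_hermite[OF S h] right_diff_distrib)
  also have "\<dots> = expectation (\<lambda>w. (I f w - F w) * ?H w)"
    using square_integrable_mult[OF If H] square_integrable_mult[OF F H] by (simp add: left_diff_distrib)
  finally have "\<bar>expectation (\<lambda>w. (I f w - F w) * ?H w)\<bar> = \<bar>fact k * (f \<bullet> t (\<lambda>_. h) - (\<Sum>g\<in>S. a g * (g \<bullet> h) ^ k))\<bar>"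
    by simp
  then have "fact k * \<bar>f \<bullet> t (\<lambda>_. h) - (\<Sum>g\<in>S. a g * (g \<bullet> h) ^ k)\<bar> = \<bar>expectation (\<lambda>w. (I f w - F w) * ?H w)\<bar>"
    by (simp add: abs_mult)
  also have "\<dots> \<le> expectation (\<lambda>w. \<bar>(I f w - F w) * ?H w\<bar>)" by (rule integral_abs_bound)
  also have "\<dots> \<le> \<tau> * (1 + fact k) / 2"
    using expectation_mult_le[OF square_integrable_diff[OF If F] H \<tau>] le unfolding F_def EH by simp
  also have "\<dots> \<le> fact k * \<tau>"
    using \<tau> fact_ge_1[of k, where ?'a = real] by (simp add: field_simps)
  finally show ?thesis using fact_gt_zero[of k, where ?'a = real] by simp
qed

text \<open>Transfers the bound from Hermite sums to the integrals. The sums depend on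
  \<open>\<phi>\<close> through the tolerance \<open>\<tau>\<close>, but \<open>L\<close> disappears
  from the conclusion, as \<open>tv_dist_le_lipschitz_tests\<close> requires.\<close>

lemma lipschitz_test_bound:
  assumes C: "test_function_constant k C" and k: "k \<ge> 1"
    and f: "f \<in> symmetric_tensor_power k t" and g: "g \<in> symmetric_tensor_power k t"
    and h: "norm h = 1" and \<alpha>: "f \<bullet> t (\<lambda>_. h) = \<alpha>" "\<alpha> \<noteq> 0"
    and s: "0 < s" "s \<le> 1" and fg: "norm (f - g) = s ^ (2 * k)"
    and lip: "\<And>x y. \<bar>\<phi> x - \<phi> y\<bar> \<le> L * \<bar>x - y\<bar>" and bd: "\<And>x. \<bar>\<phi> x\<bar> \<le> 1"
  shows "\<bar>expectation (\<lambda>w. \<phi> (I f w)) - expectation (\<lambda>w. \<phi> (I g w))\<bar> \<le> tv_constant k C \<alpha> (norm f) * s"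
proof -
  have C0: "C \<ge> 0" using C by (simp add: test_function_constant_def)
  have L: "L \<ge> 0" using lip[of 1 0] by simp
  have cont: "continuous_on UNIV \<phi>"
  proof (rule continuous_on_subset[OF lipschitz_on_continuous_on])
    show "L-lipschitz_on UNIV \<phi>" using lip L by (intro lipschitz_onI) (auto simp: dist_real_def)
  qed simp
  have \<phi>m: "\<phi> \<in> borel_measurable borel" using cont by (rule borel_measurable_continuous_onI)
  define \<eta> where "\<eta> = s ^ (2 * k)"
  have \<eta>: "0 < \<eta>" "\<eta> \<le> 1" using s by (auto simp: \<eta>_def intro!: power_le_one)
  have \<eta>_eq: "\<eta> = s * s ^ (2 * k - 1)"
    unfolding \<eta>_def using k by (simp flip: power_Suc)
  \<comment> \<open>Three demands: \<open>\<eta>\<close> keeps the second moment of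
    \<open>F - G\<close> of order \<open>\<eta>\<^sup>2\<close>, \<open>s / (L + 1)\<close> limits
    the cost of each replacement to \<open>s\<close> (the 1 covers \<open>L = 0\<close>), and
    \<open>\<bar>\<alpha>\<bar> / 2\<close> keeps the leading coefficient away from 0.\<close>
  define \<tau> where "\<tau> = min \<eta> (min (s / (L + 1)) (\<bar>\<alpha>\<bar> / 2))"
  have \<tau>: "\<tau> > 0" using \<eta> s L \<alpha>(2) by (auto simp: \<tau>_def)
  have \<tau>_le: "\<tau> \<le> \<eta>" "\<tau> \<le> s / (L + 1)" "\<tau> \<le> \<bar>\<alpha>\<bar> / 2" 
    unfolding \<tau>_def by (rule min.cobounded1, rule min.coboundedI2[OF min.cobounded1], rule min.coboundedI2[OF min.cobounded2])
  have L\<tau>: "L * \<tau> \<le> s"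
  proof -
    have "L * \<tau> \<le> (L + 1) * \<tau>" using \<tau> by (simp add: mult_right_mono)
    also have "\<dots> \<le> (L + 1) * (s / (L + 1))" using \<tau>_le(2) L by (intro mult_left_mono) auto
    finally show ?thesis using L by simp
  qed
  have \<tau>2: "\<tau>\<^sup>2 \<le> \<eta>\<^sup>2" using \<tau> \<tau>_le(1) by (intro power_mono) auto
  have \<eta>2: "\<eta>\<^sup>2 \<le> 1" using \<eta> by (simp add: power_le_one)
  obtain S1 a1 where S1: "finite S1" "\<forall>x\<in>S1. norm x = 1"
    and le1: "expectation (\<lambda>w. (I f w - (\<Sum>x\<in>S1. a1 x * hermite k (X x w)))\<^sup>2) \<le> \<tau>\<^sup>2"
    using wiener_chaos_approximation[OF I_chaos[OF f] \<tau>] by blast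
  obtain S2 a2 where S2: "finite S2" "\<forall>x\<in>S2. norm x = 1"
    and le2: "expectation (\<lambda>w. (I g w - (\<Sum>x\<in>S2. a2 x * hermite k (X x w)))\<^sup>2) \<le> \<tau>\<^sup>2"
    using wiener_chaos_approximation[OF I_chaos[OF g] \<tau>] by blast
  \<comment> \<open>A common index set, with coefficients extended by 0, so that \<open>F\<close>
    and \<open>G\<close> are conditioned on the same remainders.\<close>
  define S where "S = S1 \<union> S2"
  define a where "a x = (if x \<in> S1 then a1 x else 0)" for x
  define b where "b x = (if x \<in> S2 then a2 x else 0)" for x
  have S: "finite S" "\<And>x. x \<in> S \<Longrightarrow> norm x = 1" using S1 S2 by (auto simp: S_def)
  define F where "F = (\<lambda>w. \<Sum>x\<in>S. a x * hermite k (X x w))"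
  define G where "G = (\<lambda>w. \<Sum>x\<in>S. b x * hermite k (X x w))"
  have F_eq: "F w = (\<Sum>x\<in>S1. a1 x * hermite k (X x w))" for w
    unfolding F_def by (rule sum.mono_neutral_cong_right) (use S in \<open>auto simp: S_def a_def\<close>)
  have G_eq: "G w = (\<Sum>x\<in>S2. a2 x * hermite k (X x w))" for w
    unfolding G_def by (rule sum.mono_neutral_cong_right) (use S in \<open>auto simp: S_def b_def\<close>)
  have leF: "expectation (\<lambda>w. (I f w - F w)\<^sup>2) \<le> \<tau>\<^sup>2" and leG: "expectation (\<lambda>w. (I g w - G w)\<^sup>2) \<le> \<tau>\<^sup>2"
    using le1 le2 by (simp_all add: F_eq G_eq)
  have F: "square_integrable M F" and G: "square_integrable M G"
    unfolding F_def G_def by (rule hermite_sum_square_integrable[OF S(2)]; assumption)+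
  note If = I_square_integrable[OF f] and Ig = I_square_integrable[OF g]
  define \<beta> where "\<beta> = (\<Sum>x\<in>S. a x * (x \<bullet> h) ^ k)"
  have "\<bar>\<alpha> - \<beta>\<bar> \<le> \<tau>"
    unfolding \<alpha>(1)[symmetric] \<beta>_def
    by (rule diagonal_coefficient_approximation[OF f h S(2) \<tau>]) (use leF in \<open>auto simp: F_def\<close>)
  then have \<beta>: "\<bar>\<alpha>\<bar> / 2 \<le> \<bar>\<beta>\<bar>" "\<beta> \<noteq> 0" using \<tau>_le(3) \<alpha>(2) by auto
  have sq: "integrable M (\<lambda>w. (I f w - F w)\<^sup>2)" "integrable M (\<lambda>w. (I g w - G w)\<^sup>2)"
    "integrable M (\<lambda>w. (I f w - I g w)\<^sup>2)" "integrable M (\<lambda>w. (F w - G w)\<^sup>2)"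
    "integrable M (\<lambda>w. (F w)\<^sup>2)" "integrable M (\<lambda>w. (I f w)\<^sup>2)"
    using square_integrable_diff[OF If F] square_integrable_diff[OF Ig G] square_integrable_diff[OF If Ig]
      square_integrable_diff[OF F G] F If by (auto simp: square_integrable_def)
  have EFG: "expectation (\<lambda>w. (F w - G w)\<^sup>2) \<le> 3 * (fact k + 2) * \<eta>\<^sup>2"
  proof -
    have "expectation (\<lambda>w. (F w - G w)\<^sup>2)
        \<le> expectation (\<lambda>w. 3 * (I f w - F w)\<^sup>2 + (3 * (I f w - I g w)\<^sup>2 + 3 * (I g w - G w)\<^sup>2))"
    proof (rule integral_mono)
      fix w
      have "(- x + y + z)\<^sup>2 \<le> 3 * x\<^sup>2 + (3 * y\<^sup>2 + 3 * z\<^sup>2)" for x y z :: real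
        using zero_le_power2[of "x + y"] zero_le_power2[of "x + z"] zero_le_power2[of "y - z"]
        by (simp add: power2_eq_square algebra_simps)
      from this[of "I f w - F w" "I f w - I g w" "I g w - G w"]
      show "(F w - G w)\<^sup>2 \<le> 3 * (I f w - F w)\<^sup>2 + (3 * (I f w - I g w)\<^sup>2 + 3 * (I g w - G w)\<^sup>2)"
        by simp
    qed (intro sq Bochner_Integration.integrable_add integrable_mult_right)+
    also have "\<dots> = 3 * expectation (\<lambda>w. (I f w - F w)\<^sup>2)
        + (3 * (fact k * \<eta>\<^sup>2) + 3 * expectation (\<lambda>w. (I g w - G w)\<^sup>2))"
      using I_diff_square[OF f g] fg
      by (simp only: Bochner_Integration.integral_add integral_mult_right_zero sq
          Bochner_Integration.integrable_add integrable_mult_right \<eta>_def)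
    also have "\<dots> \<le> 3 * \<eta>\<^sup>2 + (3 * (fact k * \<eta>\<^sup>2) + 3 * \<eta>\<^sup>2)" using leF leG \<tau>2 by linarith
    finally show ?thesis by (simp add: algebra_simps)
  qed
  have EF: "expectation (\<lambda>w. (F w)\<^sup>2) \<le> 2 * fact k * (norm f)\<^sup>2 + 2"
  proof -
    have "expectation (\<lambda>w. (F w)\<^sup>2) \<le> expectation (\<lambda>w. 2 * (I f w)\<^sup>2 + 2 * (I f w - F w)\<^sup>2)"
    proof (rule integral_mono)
      fix w
      show "(F w)\<^sup>2 \<le> 2 * (I f w)\<^sup>2 + 2 * (I f w - F w)\<^sup>2"
        using zero_le_power2[of "2 * I f w - F w"] by (simp add: power2_eq_square algebra_simps)
    qed (intro sq Bochner_Integration.integrable_add integrable_mult_right)+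
    also have "\<dots> = 2 * (fact k * (norm f)\<^sup>2) + 2 * expectation (\<lambda>w. (I f w - F w)\<^sup>2)"
      by (simp only: Bochner_Integration.integral_add integral_mult_right_zero sq integrable_mult_right I_isometry[OF f])
    finally show ?thesis using leF \<tau>2 \<eta>2 by simp
  qed
  have "\<bar>expectation (\<lambda>w. \<phi> (F w)) - expectation (\<lambda>w. \<phi> (G w))\<bar>
    \<le> 4 * real k * s + 2 * s / \<beta>\<^sup>2 + C / s ^ (2 * k - 1) *
       (expectation (\<lambda>w. (F w - G w)\<^sup>2) / \<eta> + \<eta> * (1 + expectation (\<lambda>w. (F w)\<^sup>2)))"
    by (rule hermite_sum_test_function_bound[OF C S h \<beta>_def[symmetric] \<beta>(2) \<eta>(1) s cont bd F_def G_def])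
  also have "\<dots> \<le> 4 * real k * s + 8 * s / \<alpha>\<^sup>2 + C * s * (3 * (fact k + 2) + (3 + 2 * fact k * (norm f)\<^sup>2))"
  proof (intro add_mono order_refl)
    have "(\<bar>\<alpha>\<bar> / 2)\<^sup>2 \<le> \<bar>\<beta>\<bar>\<^sup>2" using \<beta>(1) by (intro power_mono) auto
    then have "\<alpha>\<^sup>2 / 4 \<le> \<beta>\<^sup>2" by (simp add: power_divide)
    then have "2 * s / \<beta>\<^sup>2 \<le> 2 * s / (\<alpha>\<^sup>2 / 4)" using s \<alpha>(2) \<beta>(2) by (intro divide_left_mono) auto
    then show "2 * s / \<beta>\<^sup>2 \<le> 8 * s / \<alpha>\<^sup>2" by simp
    have "expectation (\<lambda>w. (F w - G w)\<^sup>2) / \<eta> + \<eta> * (1 + expectation (\<lambda>w. (F w)\<^sup>2))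
        \<le> 3 * (fact k + 2) * \<eta>\<^sup>2 / \<eta> + \<eta> * (1 + (2 * fact k * (norm f)\<^sup>2 + 2))"
      using EFG EF \<eta>(1) by (intro add_mono divide_right_mono mult_left_mono) auto
    also have "\<dots> = \<eta> * (3 * (fact k + 2) + (3 + 2 * fact k * (norm f)\<^sup>2))"
      using \<eta>(1) by (simp add: power2_eq_square field_simps)
    finally have "C / s ^ (2 * k - 1) *
       (expectation (\<lambda>w. (F w - G w)\<^sup>2) / \<eta> + \<eta> * (1 + expectation (\<lambda>w. (F w)\<^sup>2)))
      \<le> C / s ^ (2 * k - 1) * (\<eta> * (3 * (fact k + 2) + (3 + 2 * fact k * (norm f)\<^sup>2)))"
      using C0 s by (intro mult_left_mono) auto
    also have "\<dots> = C * s * (3 * (fact k + 2) + (3 + 2 * fact k * (norm f)\<^sup>2))"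
      unfolding \<eta>_eq using s by simp
    finally show "C / s ^ (2 * k - 1) *
       (expectation (\<lambda>w. (F w - G w)\<^sup>2) / \<eta> + \<eta> * (1 + expectation (\<lambda>w. (F w)\<^sup>2)))
      \<le> C * s * (3 * (fact k + 2) + (3 + 2 * fact k * (norm f)\<^sup>2))" .
  qed
  finally have mid: "\<bar>expectation (\<lambda>w. \<phi> (F w)) - expectation (\<lambda>w. \<phi> (G w))\<bar>
    \<le> 4 * real k * s + 8 * s / \<alpha>\<^sup>2 + C * s * (3 * (fact k + 2) + (3 + 2 * fact k * (norm f)\<^sup>2))" .
  have left: "\<bar>expectation (\<lambda>w. \<phi> (I f w)) - expectation (\<lambda>w. \<phi> (F w))\<bar> \<le> s"
    using lipschitz_expectation_diff_le[OF If F \<tau> leF lip bd L \<phi>m] L\<tau> by linarith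
  have right: "\<bar>expectation (\<lambda>w. \<phi> (I g w)) - expectation (\<lambda>w. \<phi> (G w))\<bar> \<le> s"
    using lipschitz_expectation_diff_le[OF Ig G \<tau> leG lip bd L \<phi>m] L\<tau> by linarith
  have "\<bar>expectation (\<lambda>w. \<phi> (I f w)) - expectation (\<lambda>w. \<phi> (I g w))\<bar>
    \<le> 2 * s + (4 * real k * s + 8 * s / \<alpha>\<^sup>2 + C * s * (3 * (fact k + 2) + (3 + 2 * fact k * (norm f)\<^sup>2)))"
    using left right mid by linarith
  also have "\<dots> = tv_constant k C \<alpha> (norm f) * s"
    unfolding tv_constant_def by (simp add: algebra_simps)
  finally show ?thesis .
qed

lemma tv_dist_I_le:
  assumes C: "test_function_constant k C" and k: "k \<ge> 1"
    and f: "f \<in> symmetric_tensor_power k t" and g: "g \<in> symmetric_tensor_power k t"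
    and h: "norm h = 1" and \<alpha>: "f \<bullet> t (\<lambda>_. h) = \<alpha>" "\<alpha> \<noteq> 0"
  shows "tv_dist M (I g) (I f) \<le> tv_constant k C \<alpha> (norm f) * norm (g - f) powr (1 / (2 * real k))"
proof -
  have m: "I f \<in> borel_measurable M" "I g \<in> borel_measurable M"
    using I_square_integrable[OF f] I_square_integrable[OF g] by (auto simp: square_integrable_def)
  have C0: "C \<ge> 0" using C by (simp add: test_function_constant_def)
  have c1: "1 \<le> tv_constant k C \<alpha> (norm f)"
    unfolding tv_constant_def using C0 by (simp add: add_increasing2)
  define d where "d = norm (g - f)"
  \<comment> \<open>The scale \<open>s\<close> has to lie in \<open>(0, 1]\<close>. At distance 0
    the two tensors, hence the variables, coincide; beyond 1 the trivial bound suffices because the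
    constant is at least 1.\<close>
  consider "d = 0" | "0 < d" "d \<le> 1" | "1 < d" by (force simp: d_def)
  then show ?thesis
  proof cases
    case 1
    then have "g = f" by (simp add: d_def)
    then show ?thesis using tv_dist_le_lipschitz_tests[OF m(1) m(1), of 0] by simp
  next
    case 2
    define s where "s = d powr (1 / (2 * real k))"
    have s: "0 < s" "s \<le> 1" using 2 by (auto simp: s_def powr_le1)
    have "s ^ (2 * k) = s powr (2 * real k)" using s by (simp flip: powr_realpow)
    also have "\<dots> = d" using 2 k by (simp add: s_def powr_powr)
    finally have fg: "norm (f - g) = s ^ (2 * k)" by (simp add: d_def norm_minus_commute)
    have "tv_dist M (I g) (I f) \<le> tv_constant k C \<alpha> (norm f) * s"
      by (rule tv_dist_le_lipschitz_tests[OF m(2,1)])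
         (subst abs_minus_commute, rule lipschitz_test_bound[OF C k f g h \<alpha> s fg])
    then show ?thesis by (simp add: s_def d_def)
  next
    case 3
    have "1 \<le> d powr (1 / (2 * real k))" using 3 by (simp add: ge_one_powr_ge_zero)
    then have "1 \<le> tv_constant k C \<alpha> (norm f) * d powr (1 / (2 * real k))"
      using c1 mult_mono[of 1 "tv_constant k C \<alpha> (norm f)" 1 "d powr (1 / (2 * real k))"] by simp
    then show ?thesis using tv_dist_le_1[of "I g" "I f"] by (simp add: d_def)
  qed
qed

end

theorem theorem4p4:
  fixes t :: "(nat \<Rightarrow> 'h::{real_inner, complete_space, second_countable_topology})
                \<Rightarrow> 't::{real_inner, complete_space}"
    and k :: nat and f_inf :: 't
  assumes "k \<ge> 2"
    and "hilbert_tensor_power k t"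
    and "f_inf \<noteq> 0"
  shows "\<exists>c::real. \<forall>(M :: 'w measure) (X :: 'h \<Rightarrow> 'w \<Rightarrow> real) (I :: 't \<Rightarrow> 'w \<Rightarrow> real) (f :: nat \<Rightarrow> 't).
           isonormal_process M X \<longrightarrow>
           multiple_wiener_integral k t M X I \<longrightarrow>
           (\<forall>n\<ge>1. f n \<in> symmetric_tensor_power k t \<and> f n \<noteq> 0) \<longrightarrow>
           f \<longlonglongrightarrow> f_inf \<longrightarrow>
           (\<forall>n\<ge>1. tv_dist M (I (f n)) (I f_inf) \<le> c * norm (f n - f_inf) powr (1 / (2 * real k)))"
proof -
  obtain C where C: "test_function_constant k C"
    using ex_test_function_constant[of k] assms(1) by auto
  \<comment> \<open>\<open>h\<close> must not depend on the process. If there is no such vector, the choice is junk, but then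
    \<open>f_inf\<close> is not symmetric and the hypotheses on \<open>f\<close> cannot hold.\<close>
  define h where "h = (SOME h. norm h = 1 \<and> f_inf \<bullet> t (\<lambda>_. h) \<noteq> 0)"
  define \<alpha> where "\<alpha> = f_inf \<bullet> t (\<lambda>_. h)"
  show ?thesis
  proof (intro exI[of _ "tv_constant k C \<alpha> (norm f_inf)"] allI impI)
    fix M :: "'w measure" and X :: "'h \<Rightarrow> 'w \<Rightarrow> real" and I :: "'t \<Rightarrow> 'w \<Rightarrow> real" and f :: "nat \<Rightarrow> 't" and n :: nat
    assume X: "isonormal_process M X" and I: "multiple_wiener_integral k t M X I"
      and f: "\<forall>n\<ge>1. f n \<in> symmetric_tensor_power k t \<and> f n \<noteq> 0" and lim: "f \<longlonglongrightarrow> f_inf" and n: "1 \<le> n"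
    interpret wiener_integral M X k t I
      using X I assms(2) by (simp add: wiener_integral_def wiener_integral_axioms_def)
    have "closed (symmetric_tensor_power k t)" by (simp add: symmetric_tensor_power_def)
    \<comment> \<open>Membership is assumed from index 1 on, hence the shifted sequence.\<close>
    then have f_inf: "f_inf \<in> symmetric_tensor_power k t"
      by (rule closed_sequentially[of _ "\<lambda>n. f (Suc n)"]) (use f lim in \<open>auto simp: LIMSEQ_Suc\<close>)
    have "norm h = 1 \<and> f_inf \<bullet> t (\<lambda>_. h) \<noteq> 0"
      unfolding h_def using ex_nonzero_diagonal_coefficient[OF f_inf assms(3)] by (rule someI_ex)
    then show "tv_dist M (I (f n)) (I f_inf)
        \<le> tv_constant k C \<alpha> (norm f_inf) * norm (f n - f_inf) powr (1 / (2 * real k))"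
      using assms(1) f n by (intro tv_dist_I_le[OF C _ f_inf]) (auto simp: \<alpha>_def)
  qed
qed

end
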